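(* Let $i,j\ge 0$ be real numbers with $i+j=1$. Then $$\bigcap_{\psi\in\mathcal{D}}\mathbf{V}_{(i,j)}(\psi)=\mathrm{Bad}(i,j).$$ That is, an irrational vector $\mathbf{x}\in[0,1]^2$ has the property that $\mu\big(\mathbf{W}^{\mathbf{x}}_{(i,j)}(\psi)\big)=1$ for every divergent approximating function $\psi$ if and only if $\mathbf{x}\in\mathrm{Bad}(i,j)$.
   Context: $\|\cdot\|$ denotes the distance to the nearest integer. Convention: if $i=0$ then $\|y\|^{1/i}:=0$ (and likewise for $j$). A vector $\mathbf{x}=(x_1,x_2)$ is irrational if $1,x_1,x_2$ are linearly independent over $\mathbb{Q}$. $\mu$ denotes two-dimensional Lebesgue measure on $[0,1]^2$. $\mathrm{Bad}(i,j)$ is the set of irrational $\mathbf{x}\in[0,1]^2$ for which there is a constant $c(\mathbf{x})>0$ with $\max\{\|qx_1\|^{1/i},\|qx_2\|^{1/j}\}>c(\mathbf{x})/q$ for all $q\in\mathbb{N}$. An approximating function is a strictly positive non-increasing map $\psi:\mathbb{N}\to\mathbb{R}$; $\mathcal{D}$ is the set of approximating functions with $\sum_{r=1}^\infty\psi(r)=\infty$. For an approximating function $\psi$ and irrational $\mathbf{x}\in[0,1]^2$, $\mathbf{W}^{\mathbf{x}}_{(i,j)}(\psi)$ is the set of $\boldsymbol\gamma=(\gamma_1,\gamma_2)\in[0,1]^2$ such that $\max\{\|qx_1-\gamma_1\|^{1/i},\|qx_2-\gamma_2\|^{1/j}\}\le\psi(|q|)$ for infinitely many nonzero integers $q$.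 For $\psi\in\mathcal{D}$, $\mathbf{V}_{(i,j)}(\psi):=\{\text{irrational }\mathbf{x}\in[0,1]^2:\ \mu(\mathbf{W}^{\mathbf{x}}_{(i,j)}(\psi))=1\}$. *)

theory Defs
  imports "HOL-Analysis.Analysis"
begin

definition nint_dist :: "real \<Rightarrow> real" where
  "nint_dist y = \<bar>y - of_int (round y)\<bar>"

definition rpow_inv :: "real \<Rightarrow> real \<Rightarrow> real" where
  "rpow_inv y i = (if i = 0 then 0 else y powr (1 / i))"

definition irrational_vec :: "real \<times> real \<Rightarrow> bool" where
  "irrational_vec x \<longleftrightarrow>
     (\<forall>a b c :: rat. of_rat a + of_rat b * fst x + of_rat c * snd x = 0
        \<longrightarrow> a = 0 \<and> b = 0 \<and> c = 0)"

definition unit_square :: "(real \<times> real) set" where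
  "unit_square = {0..1} \<times> {0..1}"

definition Bad :: "real \<Rightarrow> real \<Rightarrow> (real \<times> real) set" where
  "Bad i j = {x \<in> unit_square. irrational_vec x \<and>
     (\<exists>c>0. \<forall>q::nat. q \<ge> 1 \<longrightarrow>
        max (rpow_inv (nint_dist (real q * fst x)) i)
            (rpow_inv (nint_dist (real q * snd x)) j) > c / real q)}"

definition approx_fun :: "(nat \<Rightarrow> real) \<Rightarrow> bool" where
  "approx_fun \<psi> \<longleftrightarrow> (\<forall>r. \<psi> r > 0) \<and> antimono \<psi>"

text \<open>Divergent approximating functions (defined on positive integers; value at 0 irrelevant).\<close>
definition D_set :: "(nat \<Rightarrow> real) set" where
  "D_set = {\<psi>. approx_fun \<psi> \<and> \<not> summable (\<lambda>r. \<psi> (Suc r))}"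

definition W_set :: "real \<Rightarrow> real \<Rightarrow> (nat \<Rightarrow> real) \<Rightarrow> real \<times> real \<Rightarrow> (real \<times> real) set" where
  "W_set i j \<psi> x = {\<gamma> \<in> unit_square.
     infinite {q::int. q \<noteq> 0 \<and>
       max (rpow_inv (nint_dist (of_int q * fst x - fst \<gamma>)) i)
           (rpow_inv (nint_dist (of_int q * snd x - snd \<gamma>)) j) \<le> \<psi> (nat \<bar>q\<bar>)}}"

definition V_set :: "real \<Rightarrow> real \<Rightarrow> (nat \<Rightarrow> real) \<Rightarrow> (real \<times> real) set" where
  "V_set i j \<psi> = {x \<in> unit_square. irrational_vec x \<and>
     W_set i j \<psi> x \<in> sets lebesgue \<and> emeasure lebesgue (W_set i j \<psi> x) = 1}"

end

theory Submission
  imports Defs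
begin

text \<open>
  Write \<open>R q\<close> for the rectangle around \<open>q x\<close> modulo 1 with half-sides \<open>\<psi>(q)\<^sup>i\<close> and \<open>\<psi>(q)\<^sup>j\<close>; its measure is
  of order \<open>\<psi> q\<close>.

  If \<open>x\<close> is not badly approximable, choose \<open>q\<^sub>k\<close> with an exceptionally small error and put
  \<open>N\<^sub>k = 2\<^sup>k q\<^sub>k\<close>. The points \<open>q x\<close> with \<open>\<bar>q\<bar> \<le> N\<^sub>k\<close> then cluster around only \<open>q\<^sub>k\<close> points, so with
  \<open>\<psi> = 1 / N\<^sub>k\<close> on \<open>N\<^sub>k\<^sub>-\<^sub>1 < r \<le> N\<^sub>k\<close> the targets of the \<open>k\<close>-th block have total measure
  \<open>O(2\<^sup>-\<^sup>k)\<close> and the Borel--Cantelli lemma applies, although \<open>\<psi>\<close> has divergent sum.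

  If \<open>x\<close> is badly approximable, let \<open>f = \<Sum>q\<le>n. indicator (R q)\<close> and \<open>S = \<Sum>q\<le>n. \<psi> q\<close>. The \<open>r\<close> for
  which \<open>R (p + r)\<close> meets \<open>R p\<close> have gaps of order at least \<open>1 / \<psi> p\<close>, so monotonicity of \<open>\<psi>\<close> bounds the
  second moment of \<open>f\<close> by \<open>O(S\<^sup>2)\<close>. On the other hand the integral of \<open>f\<close> over a box \<open>B\<close> is at
  least \<open>\<mu> B / 9 * S - O(1)\<close>: by Kronecker's theorem \<open>9 / \<mu> B\<close> translates of \<open>B\<close> by multiples
  \<open>p x\<close> cover the torus, and translating by \<open>p x\<close> only shifts the index of the targets. A set of
  positive measure on which \<open>f\<close> stays bounded is nearly a finite union of boxes, which
  contradicts these two estimates by the Cauchy--Schwarz inequality.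
\<close>

section \<open>Distance to the nearest integer and the measure of targets\<close>

lemma nint_dist_nonneg [simp]: "0 \<le> nint_dist y"
  by (simp add: nint_dist_def)

lemma nint_dist_le_half: "nint_dist y \<le> 1/2"
  unfolding nint_dist_def using of_int_round_abs_le[of y] by (simp add: abs_minus_commute)

lemma nint_dist_le: "nint_dist y \<le> \<bar>y - of_int m\<bar>"
  unfolding nint_dist_def by (rule round_diff_minimal)

lemma nint_dist_triangle: "nint_dist (y + z) \<le> nint_dist y + nint_dist z"
proof -
  have "nint_dist (y + z) \<le> \<bar>(y + z) - of_int (round y + round z)\<bar>"
    by (rule nint_dist_le)
  also have "\<dots> \<le> nint_dist y + nint_dist z"
    unfolding nint_dist_def by (simp add: abs_if)
  finally show ?thesis .
qed

lemma nint_dist_minus [simp]: "nint_dist (- y) = nint_dist y"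
proof -
  have "nint_dist (- y) \<le> nint_dist y" for y
    using nint_dist_le[of "-y" "- round y"] unfolding nint_dist_def by simp
  from this[of y] this[of "-y"] show ?thesis by simp
qed

lemma nint_dist_triangle_diff: "nint_dist (y - z) \<le> nint_dist y + nint_dist z"
  using nint_dist_triangle[of y "- z"] by simp

lemma nint_dist_add_int [simp]: "nint_dist (y + of_int m) = nint_dist y"
proof -
  have "round (y + of_int m) = round y + m"
    unfolding round_def by (metis floor_add_int add.commute add.left_commute)
  then show ?thesis by (simp add: nint_dist_def)
qed

lemma nint_dist_of_nat_mult: "nint_dist (of_nat n * y) \<le> of_nat n * nint_dist y"
proof (induction n)
  case (Suc n)
  then show ?case
    using nint_dist_triangle[of y "of_nat n * y"] by (simp add: algebra_simps)
qed (simp add: nint_dist_def)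

lemma nint_dist_of_int_mult: "nint_dist (of_int k * y) \<le> \<bar>of_int k\<bar> * nint_dist y"
proof (cases "k \<ge> 0")
  case True
  then show ?thesis using nint_dist_of_nat_mult[of "nat k" y] by simp
next
  case False
  have "of_int k * y = - (of_nat (nat (-k)) * y)" using False by simp
  then have "nint_dist (of_int k * y) = nint_dist (of_nat (nat (-k)) * y)"
    by (metis nint_dist_minus)
  then show ?thesis using nint_dist_of_nat_mult[of "nat (-k)" y] False by simp
qed

lemma nint_dist_pos: "y \<notin> \<int> \<Longrightarrow> 0 < nint_dist y"
  unfolding nint_dist_def by (metis Ints_of_int eq_iff_diff_eq_0 zero_less_abs_iff)

lemma borel_measurable_nint_dist [measurable]: "nint_dist \<in> borel_measurable borel"
  unfolding nint_dist_def[abs_def] round_def by measurable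

text \<open>For \<open>i = 0\<close> both sides hold: the left by convention, the right because
  \<open>t powr 0 = 1\<close> exceeds every distance to an integer. Plain powers thus absorb the
  convention.\<close>

lemma rpow_inv_le_iff:
  assumes "0 \<le> i" "0 < t"
  shows "rpow_inv (nint_dist y) i \<le> t \<longleftrightarrow> nint_dist y \<le> t powr i"
proof (cases "i = 0")
  case True
  then show ?thesis
    using assms nint_dist_le_half[of y] by (simp add: rpow_inv_def)
next
  case False
  then have "i > 0" using assms by simp
  have "nint_dist y = (nint_dist y powr (1/i)) powr i"
    using \<open>i > 0\<close> by (simp add: powr_powr)
  then have "nint_dist y \<le> t powr i \<longleftrightarrow> (nint_dist y powr (1/i)) powr i \<le> t powr i" by simp
  also have "\<dots> \<longleftrightarrow> nint_dist y powr (1/i) \<le> t"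
    using \<open>i > 0\<close> assms by (meson powr_mono2 powr_ge_zero not_le powr_less_mono2 less_imp_le)
  finally show ?thesis using False by (simp add: rpow_inv_def)
qed

section \<open>Translation invariance on the circle\<close>

lemma measure_lborel_vimage_plus:
  fixes S :: "'a::euclidean_space set"
  assumes "S \<in> sets borel"
  shows "measure lborel ((\<lambda>t. t + c) -` S) = measure lborel S"
proof -
  have "measure lborel S = measure (distr lborel borel ((+) c)) S"
    by (simp add: lborel_distr_plus)
  also have "\<dots> = measure lborel ((+) c -` S \<inter> space lborel)"
    using assms by (intro measure_distr) auto
  also have "(+) c -` S \<inter> space lborel = (\<lambda>t. t + c) -` S"
    by (auto simp: add.commute)
  finally show ?thesis ..
qed

text \<open>Rotation of the circle, expressed on the unit interval instead of a quotient. With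
  \<open>u\<close> the fractional part of \<open>s\<close>, the interval is cut at
  \<open>1 - u\<close>; one piece moves by \<open>u\<close>, the other by \<open>u - 1\<close>, and
  periodicity preserves membership in \<open>P\<close>.\<close>

lemma measure_periodic_translate:
  fixes P :: "real set"
  assumes [measurable]: "P \<in> sets borel" and per: "\<And>t. t + 1 \<in> P \<longleftrightarrow> t \<in> P"
  shows "measure lborel ({0..1} \<inter> (\<lambda>t. t + s) -` P) = measure lborel ({0..1} \<inter> P)"
proof -
  have per_int: "t + of_int m \<in> P \<longleftrightarrow> t \<in> P" for t m
  proof (induction m rule: int_induct[where k = 0])
    case (step1 i)
    then show ?case using per[of "t + of_int i"] by (simp add: add.assoc)
  next
    case (step2 i)
    then show ?case using per[of "t + of_int (i - 1)"] by (simp add: add.assoc)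
  qed simp
  have fin: "S \<in> fmeasurable lborel" if "S \<in> sets borel" "S \<subseteq> {0..1}" for S :: "real set"
    by (rule fmeasurableI2[OF _ that(2)]) (use that(1) in \<open>auto simp: fmeasurable_def\<close>)
  define u where "u = frac s"
  have u: "0 \<le> u" "u < 1" by (auto simp: u_def frac_lt_1)
  have "t + s \<in> P \<longleftrightarrow> t + u \<in> P" for t
    using per_int[of "t + u" "\<lfloor>s\<rfloor>"] by (simp add: u_def frac_def)
  then have "{0..1} \<inter> (\<lambda>t. t + s) -` P = {0..1} \<inter> (\<lambda>t. t + u) -` P" by auto
  \<comment> \<open>The endpoints 0 and 1 are one point of the circle; one of them is discarded as a
    null set so that the two pieces fit exactly.\<close>
  also have "measure lborel \<dots> = measure lborel ({0..<1} \<inter> (\<lambda>t. t + u) -` P)"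
    by (rule measure_eq_AE, use AE_lborel_singleton[of "1::real"] in eventually_elim) auto
  also have "\<dots> = measure lborel ({0..<1-u} \<inter> (\<lambda>t. t + u) -` P) + measure lborel ({1-u..<1} \<inter> (\<lambda>t. t + u) -` P)"
  proof -
    have e: "{0..<1} \<inter> (\<lambda>t. t + u) -` P = ({0..<1-u} \<inter> (\<lambda>t. t + u) -` P) \<union> ({1-u..<1} \<inter> (\<lambda>t. t + u) -` P)"
      using u by auto
    show ?thesis unfolding e
      by (rule measure_Un_AE) (use u in \<open>auto intro!: fin\<close>)
  qed
  also have "measure lborel ({0..<1-u} \<inter> (\<lambda>t. t + u) -` P) = measure lborel ({u..<1} \<inter> P)"
  proof -
    have "{0..<1-u} \<inter> (\<lambda>t. t + u) -` P = (\<lambda>t. t + u) -` ({u..<1} \<inter> P)" by auto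
    then show ?thesis by (simp add: measure_lborel_vimage_plus del: vimage_Int)
  qed
  also have "measure lborel ({1-u..<1} \<inter> (\<lambda>t. t + u) -` P) = measure lborel ({0..<u} \<inter> P)"
  proof -
    have "{1-u..<1} \<inter> (\<lambda>t. t + u) -` P = (\<lambda>t. t + (u - 1)) -` ({0..<u} \<inter> P)"
      using per[of "t + (u - 1)" for t] by auto
    then show ?thesis by (simp add: measure_lborel_vimage_plus del: vimage_Int)
  qed
  also have "measure lborel ({u..<1} \<inter> P) + measure lborel ({0..<u} \<inter> P) = measure lborel ({0..<1} \<inter> P)"
  proof -
    have e: "{0..<1} \<inter> P = ({u..<1} \<inter> P) \<union> ({0..<u} \<inter> P)" using u by auto
    show ?thesis unfolding e
      by (rule measure_Un_AE[symmetric]) (use u in \<open>auto intro!: fin\<close>)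
  qed
  also have "\<dots> = measure lborel ({0..1} \<inter> P)"
    by (rule measure_eq_AE, use AE_lborel_singleton[of "1::real"] in eventually_elim) auto
  finally show ?thesis .
qed

text \<open>One coordinate of moving a window and a target by the same vector. Both conditions have
  period 1, so rotation applies to their conjunction.\<close>

lemma measure_nint_dist_shift:
  "measure lborel {t\<in>{0..1}. nint_dist (t - (a + s)) < w \<and> nint_dist (b + s - t) \<le> r} =
   measure lborel {t\<in>{0..1}. nint_dist (t - a) < w \<and> nint_dist (b - t) \<le> r}"
proof -
  let ?P = "{t. nint_dist (t - a) < w \<and> nint_dist (b - t) \<le> r}"
  have per: "t + 1 \<in> ?P \<longleftrightarrow> t \<in> ?P" for t
    using nint_dist_add_int[of "t - a" 1] nint_dist_add_int[of "b - t" "-1"]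
    by (simp add: algebra_simps)
  have "measure lborel ({0..1} \<inter> (\<lambda>t. t + (- s)) -` ?P) = measure lborel ({0..1} \<inter> ?P)"
    by (rule measure_periodic_translate) (simp, rule per)
  moreover have "{0..1} \<inter> (\<lambda>t. t + (- s)) -` ?P = {t\<in>{0..1}. nint_dist (t - (a + s)) < w \<and> nint_dist (b + s - t) \<le> r}"
    by (auto simp: algebra_simps)
  moreover have "{0..1} \<inter> ?P = {t\<in>{0..1}. nint_dist (t - a) < w \<and> nint_dist (b - t) \<le> r}"
    by auto
  ultimately show ?thesis by simp
qed

text \<open>By rotation every centre gives the same measure. The centre 1/2 is convenient because
  there the distance is an ordinary absolute value on the whole interval, without
  wrap-around.\<close>

lemma measure_near_eq:
  "measure lborel {t\<in>{0..1}. nint_dist (a - t) \<le> r} = measure lborel {t\<in>{0..1::real}. \<bar>t - 1/2\<bar> \<le> r}"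
proof -
  have half: "nint_dist y < 1" for y
    using nint_dist_le_half[of y] by linarith
  have "nint_dist (1/2 - t) = \<bar>t - 1/2\<bar>" if "t \<in> {0..1}" for t
  proof (rule antisym)
    show "nint_dist (1/2 - t) \<le> \<bar>t - 1/2\<bar>"
      using nint_dist_le[of "1/2 - t" 0] by (simp add: abs_minus_commute)
    define m where "m = round (1/2 - t)"
    consider "m = 0" | "m \<ge> 1" | "m \<le> -1" by linarith
    then have "\<bar>t - 1/2\<bar> \<le> \<bar>1/2 - t - of_int m\<bar>"
    proof cases
      case 2
      then have "real_of_int m \<ge> 1" by linarith
      then show ?thesis using that by (auto simp: abs_if)
    next
      case 3
      then have "real_of_int m \<le> -1" by linarith
      then show ?thesis using that by (auto simp: abs_if)
    qed auto
    then show "\<bar>t - 1/2\<bar> \<le> nint_dist (1/2 - t)"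
      by (simp add: nint_dist_def m_def)
  qed
  then have "{t\<in>{0..1::real}. \<bar>t - 1/2\<bar> \<le> r} = {t\<in>{0..1}. nint_dist (1/2 - t) \<le> r}"
    by auto
  \<comment> \<open>A window of width 1 imposes no condition, so the shift lemma moves the near set
    alone.\<close>
  then show ?thesis
    using measure_nint_dist_shift[of 0 "a - 1/2" 1 "1/2" r] half by simp
qed

lemma measure_near_le:
  assumes "0 \<le> r"
  shows "measure lborel {t\<in>{0..1}. nint_dist (a - t) \<le> r} \<le> 2 * r"
proof -
  have "measure lborel {t\<in>{0..1::real}. \<bar>t - 1/2\<bar> \<le> r} \<le> measure lborel {1/2 - r..1/2 + r}"
    by (rule measure_mono_fmeasurable)
      (use fmeasurable_cbox[of "1/2 - r" "1/2 + r"] in \<open>auto simp: abs_le_iff\<close>)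
  then show ?thesis
    unfolding measure_near_eq using assms by simp
qed

text \<open>Only half of the expected length \<open>2 * r\<close> is claimed, so that the bound
  survives up to \<open>r = 1\<close>, where the set is already the whole interval. Radius 1 occurs
  for the exponent 0.\<close>

lemma measure_near_ge:
  assumes "0 \<le> r" "r \<le> 1"
  shows "r \<le> measure lborel {t\<in>{0..1}. nint_dist (a - t) \<le> r}"
proof -
  have "measure lborel {1/2 - r/2..1/2 + r/2} \<le> measure lborel {t\<in>{0..1::real}. \<bar>t - 1/2\<bar> \<le> r}"
    by (rule measure_mono_fmeasurable, use assms in \<open>auto simp: abs_le_iff field_simps\<close>)
      (rule fmeasurableI2[of "{0..1}"], auto simp: fmeasurable_def)
  then show ?thesis
    unfolding measure_near_eq using assms by simp
qed

section \<open>Targets as products of arcs\<close>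

lemma measure_lborel_Times:
  fixes A B :: "real set"
  assumes "A \<in> sets borel" "B \<in> sets borel"
  shows "measure lborel (A \<times> B) = measure lborel A * measure lborel B"
proof -
  have "emeasure (lborel \<Otimes>\<^sub>M lborel) (A \<times> B) = emeasure lborel A * emeasure lborel B"
    using assms by (intro lborel.emeasure_pair_measure_Times) auto
  then show ?thesis
    by (simp add: lborel_prod measure_def enn2real_mult)
qed

text \<open>For \<open>t > 0\<close> an exponent \<open>0\<close> gives the vacuous condition \<open>nint_dist y \<le> 1\<close>, in agreement with
  the convention for \<open>i = 0\<close>.\<close>
definition target :: "real \<Rightarrow> real \<Rightarrow> real \<times> real \<Rightarrow> int \<Rightarrow> real \<Rightarrow> (real \<times> real) set" where
  "target i j x q t = {\<gamma> \<in> unit_square.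
     nint_dist (of_int q * fst x - fst \<gamma>) \<le> t powr i \<and>
     nint_dist (of_int q * snd x - snd \<gamma>) \<le> t powr j}"

lemma target_eq_Times:
  "target i j x q t = {s\<in>{0..1}. nint_dist (of_int q * fst x - s) \<le> t powr i} \<times>
     {s\<in>{0..1}. nint_dist (of_int q * snd x - s) \<le> t powr j}"
  by (auto simp: target_def unit_square_def)

lemma sets_target [measurable]: "target i j x q t \<in> sets borel"
  unfolding target_eq_Times by (intro borel_Times) measurable

lemma target_subset: "target i j x q t \<subseteq> unit_square"
  by (auto simp: target_def)

lemma target_mono:
  assumes "0 \<le> i" "0 \<le> j" "0 \<le> s" "s \<le> t"
  shows "target i j x q s \<subseteq> target i j x q t"
  using assms powr_mono2[of i s t] powr_mono2[of j s t] by (force simp: target_def)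

lemma W_set_eq:
  assumes "0 \<le> i" "0 \<le> j" "\<And>r. 0 < \<psi> r"
  shows "W_set i j \<psi> x = {\<gamma> \<in> unit_square. infinite {q::int. q \<noteq> 0 \<and> \<gamma> \<in> target i j x q (\<psi> (nat \<bar>q\<bar>))}}"
  unfolding W_set_def target_def using assms by (auto simp: rpow_inv_le_iff)

lemma fmeasurable_unit_square: "unit_square \<in> fmeasurable lborel"
proof -
  have "unit_square = cbox (0, 0) (1, 1)"
    by (auto simp: unit_square_def)
  then show ?thesis by (metis fmeasurable_cbox)
qed

lemma fmeasurable_target: "target i j x q t \<in> fmeasurable lborel"
  by (rule fmeasurableI2[OF fmeasurable_unit_square target_subset]) simp

lemma measure_unit_square: "measure lborel unit_square = 1"
  unfolding unit_square_def by (subst measure_lborel_Times) auto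

lemma measure_target_le:
  assumes "0 \<le> i" "0 \<le> j" "i + j = 1" "0 < t"
  shows "measure lborel (target i j x q t) \<le> 4 * t"
proof -
  have "measure lborel (target i j x q t) \<le> (2 * t powr i) * (2 * t powr j)"
    unfolding target_eq_Times
    by (subst measure_lborel_Times, measurable) (intro mult_mono measure_near_le; simp)
  also have "\<dots> = 4 * t powr (i + j)"
    by (simp add: powr_add)
  finally show ?thesis using assms by simp
qed

lemma measure_target_ge:
  assumes "0 \<le> i" "0 \<le> j" "i + j = 1" "0 < t" "t \<le> 1"
  shows "t \<le> measure lborel (target i j x q t)"
proof -
  have "t = t powr i * t powr j"
    using assms by (simp flip: powr_add)
  also have "\<dots> \<le> measure lborel (target i j x q t)"
    unfolding target_eq_Times using assms
    by (subst measure_lborel_Times, measurable) (intro mult_mono measure_near_ge; simp add: powr_le1)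
  finally show ?thesis .
qed

section \<open>Not badly approximable vectors\<close>

lemma irrational_vec_mult_notin_Ints:
  assumes "irrational_vec x" "q > 0"
  shows "real q * fst x \<notin> \<int>" "real q * snd x \<notin> \<int>"
proof -
  have *: "of_rat (of_int (- m)) + of_rat (of_nat q) * fst x + of_rat 0 * snd x \<noteq> 0"
    "of_rat (of_int (- m)) + of_rat 0 * fst x + of_rat (of_nat q) * snd x \<noteq> 0" for m
    using assms unfolding irrational_vec_def
    by (metis of_nat_eq_0_iff less_irrefl)+
  show "real q * fst x \<notin> \<int>" "real q * snd x \<notin> \<int>"
    using * by (auto elim!: Ints_cases simp: of_rat_minus)
qed

section \<open>Good approximations to a vector outside \<open>Bad\<close>\<close>

definition approx_error :: "real \<Rightarrow> real \<Rightarrow> real \<times> real \<Rightarrow> nat \<Rightarrow> real" where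
  "approx_error i j x q = max (rpow_inv (nint_dist (real q * fst x)) i)
     (rpow_inv (nint_dist (real q * snd x)) j)"

lemma approx_error_pos:
  assumes "irrational_vec x" "q > 0" "0 \<le> i" "0 \<le> j" "i + j = 1"
  shows "0 < approx_error i j x q"
proof -
  have "0 < nint_dist (real q * fst x)" "0 < nint_dist (real q * snd x)"
    using irrational_vec_mult_notin_Ints[OF assms(1,2)] by (auto intro: nint_dist_pos)
  then show ?thesis
    using assms by (auto simp: approx_error_def rpow_inv_def less_max_iff_disj)
qed

lemma approx_error_le_iff:
  assumes "0 \<le> i" "0 \<le> j" "0 < t"
  shows "approx_error i j x q \<le> t \<longleftrightarrow>
    nint_dist (real q * fst x) \<le> t powr i \<and> nint_dist (real q * snd x) \<le> t powr j"
  using assms by (simp add: approx_error_def rpow_inv_le_iff)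

text \<open>Errors are positive by irrationality, so a constant \<open>c0\<close> can be put at or
  below half of \<open>q * approx_error i j x q\<close> for every \<open>q < Q\<close>. A
  denominator that violates the condition for \<open>c0\<close> must then be at least
  \<open>Q\<close>.\<close>

lemma not_Bad_approx:
  assumes x: "x \<in> unit_square" "irrational_vec x" "x \<notin> Bad i j"
    and ij: "0 \<le> i" "0 \<le> j" "i + j = 1" and "0 < c"
  obtains q where "q \<ge> Q" "q > 0" "approx_error i j x q \<le> c / real q"
proof -
  define S where "S = insert c ((\<lambda>q. real q * approx_error i j x q / 2) ` {1..<Q})"
  define c0 where "c0 = Min S"
  have S: "finite S" "S \<noteq> {}" by (auto simp: S_def)
  have "0 < c0"
    unfolding c0_def using S \<open>0 < c\<close> approx_error_pos[OF x(2) _ ij]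
    by (subst Min_gr_iff) (auto simp: S_def)
  then obtain q where q: "q \<ge> 1" "approx_error i j x q \<le> c0 / real q"
    using x unfolding Bad_def approx_error_def by (simp add: not_less) (meson not_less)
  have "c0 \<le> c" unfolding c0_def using S by (auto simp: S_def)
  have "Q \<le> q"
  proof (rule ccontr)
    assume "\<not> Q \<le> q"
    then have "c0 \<le> real q * approx_error i j x q / 2"
      unfolding c0_def using S q(1) by (intro Min_le) (auto simp: S_def)
    moreover have "real q * approx_error i j x q \<le> c0"
      using q by (simp add: field_simps)
    ultimately show False using \<open>0 < c0\<close> by simp
  qed
  moreover have "approx_error i j x q \<le> c / real q"
    using q(2) \<open>c0 \<le> c\<close> by (meson divide_right_mono of_nat_0_le_iff order_trans)
  ultimately show ?thesis using q(1) that by auto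
qed

text \<open>Since \<open>t powr i\<close> is at most \<open>1 / L\<close>, a factor \<open>t\<close>
  inside the power pays for a factor \<open>L\<close> outside.\<close>

lemma powr_cancel_factor:
  fixes e L :: real
  assumes "0 < i" "0 < e" "0 < L" "y \<le> (e * t) powr i" "0 \<le> t" "t \<le> L powr (- 1 / i)"
  shows "L * y \<le> e powr i"
proof -
  have "(e * t) powr i \<le> (e * L powr (- 1 / i)) powr i"
    using assms by (intro powr_mono2 mult_left_mono) auto
  also have "\<dots> = e powr i / L"
    using assms by (simp add: powr_mult powr_powr divide_inverse powr_minus[of _ 1] flip: powr_minus)
  finally have "L * (e * t) powr i \<le> e powr i" using assms by (simp add: field_simps)
  moreover have "L * y \<le> L * (e * t) powr i" using assms by simp
  ultimately show ?thesis by linarith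
qed

text \<open>The error must stay small for multiples of \<open>q\<close> by factors up to
  \<open>L\<close>. With exponent 0 the right-hand side is 1 whatever the base and cannot absorb
  \<open>L\<close>; hence the disjunctions.\<close>

lemma not_Bad_approx_scaled:
  assumes x: "x \<in> unit_square" "irrational_vec x" "x \<notin> Bad i j"
    and ij: "0 \<le> i" "0 \<le> j" "i + j = 1" and "0 < e" "0 < L"
  obtains q where "q \<ge> Q" "q > 0" 
    "i = 0 \<or> L * nint_dist (real q * fst x) \<le> (e / real q) powr i"
    "j = 0 \<or> L * nint_dist (real q * snd x) \<le> (e / real q) powr j"
proof -
  \<comment> \<open>For an exponent 0 division by zero gives \<open>L powr 0 = 1\<close>, a harmless
    bound.\<close>
  define t where "t = min (L powr (- 1 / i)) (L powr (- 1 / j))"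
  have t: "0 < t" "t \<le> L powr (- 1 / i)" "t \<le> L powr (- 1 / j)"
    using \<open>0 < L\<close> by (auto simp: t_def)
  obtain q where q: "q \<ge> Q" "q > 0" "approx_error i j x q \<le> (e * t) / real q"
    using not_Bad_approx[OF x ij, of "e * t" Q] t \<open>0 < e\<close> by auto
  then have "nint_dist (real q * fst x) \<le> (e / q * t) powr i"
    "nint_dist (real q * snd x) \<le> (e / q * t) powr j"
    using ij t \<open>0 < e\<close> by (simp_all add: approx_error_le_iff)
  note near = this
  have "0 < e / q" using \<open>0 < e\<close> q(2) by simp
  note scale = powr_cancel_factor[OF _ this \<open>0 < L\<close> _ less_imp_le[OF t(1)]]
  have "i = 0 \<or> L * nint_dist (real q * fst x) \<le> (e / real q) powr i"
    using scale[OF _ near(1) t(2)] ij(1) by linarith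
  moreover have "j = 0 \<or> L * nint_dist (real q * snd x) \<le> (e / real q) powr j"
    using scale[OF _ near(2) t(3)] ij(2) by linarith
  ultimately show ?thesis
    using q(1,2) that by blast
qed

lemma measure_near_Times_le:
  assumes "0 \<le> u" "0 \<le> v"
  shows "measure lborel ({s\<in>{0..1}. nint_dist (a - s) \<le> u} \<times> {s\<in>{0..1}. nint_dist (b - s) \<le> v}) \<le> 4 * u * v"
proof -
  have "measure lborel ({s\<in>{0..1}. nint_dist (a - s) \<le> u} \<times> {s\<in>{0..1}. nint_dist (b - s) \<le> v}) \<le> (2 * u) * (2 * v)"
    using assms by (subst measure_lborel_Times, measurable) (intro mult_mono measure_near_le; simp)
  then show ?thesis by simp
qed

text \<open>\<open>\<kappa> r\<close> is the index of the block containing \<open>r\<close>. At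
  least half of the indices up to \<open>N (Suc k)\<close> lie beyond \<open>N k\<close>, so each
  block adds at least 1/2.\<close>

lemma not_summable_block_reciprocal:
  fixes N :: "nat \<Rightarrow> nat"
  assumes N: "0 < N 0" "\<And>k. 2 * N k \<le> N (Suc k)"
  defines "\<kappa> \<equiv> \<lambda>r. LEAST k. r \<le> N k"
  shows "\<not> summable (\<lambda>r. 1 / real (N (\<kappa> (Suc r))))"
proof
  have pos: "0 < N k" for k
  proof (induction k)
    case (Suc k)
    then show ?case using N(2)[of k] by linarith
  qed (rule N(1))
  have mono: "mono N"
    unfolding mono_iff_le_Suc using N(2) by (metis le_add1 mult_2 order_trans)
  have partial: "real k / 2 \<le> (\<Sum>r<N k. 1 / real (N (\<kappa> (Suc r))))" for k
  proof (induction k)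
    case 0
    show ?case by (simp add: sum_nonneg)
  next
    case (Suc k)
    \<comment> \<open>The shift by \<open>Suc\<close> turns the block
      \<open>N k < r \<le> N (Suc k)\<close> into the half-open range used for the partial
      sums.\<close>
    have \<kappa>: "\<kappa> (Suc r) = Suc k" if "r \<in> {N k..<N (Suc k)}" for r
      unfolding \<kappa>_def
    proof (rule Least_equality)
      show "Suc k \<le> l" if "Suc r \<le> N l" for l
      proof (rule ccontr)
        assume "\<not> Suc k \<le> l"
        then have "N l \<le> N k" using mono by (simp add: monoD)
        with \<open>Suc r \<le> N l\<close> \<open>r \<in> _\<close> show False by simp
      qed
    qed (use that in auto)
    have "1/2 \<le> real (N (Suc k) - N k) / real (N (Suc k))"
      using N(2)[of k] pos[of "Suc k"] by (simp add: field_simps of_nat_diff)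
    also have "\<dots> = (\<Sum>r = N k..<N (Suc k). 1 / real (N (\<kappa> (Suc r))))"
      by (simp add: \<kappa>)
    finally have "1/2 \<le> (\<Sum>r = N k..<N (Suc k). 1 / real (N (\<kappa> (Suc r))))" .
    moreover have "(\<Sum>r<N (Suc k). 1 / real (N (\<kappa> (Suc r)))) =
      (\<Sum>r<N k. 1 / real (N (\<kappa> (Suc r)))) + (\<Sum>r = N k..<N (Suc k). 1 / real (N (\<kappa> (Suc r))))"
      using mono monoD[OF mono, of k "Suc k"]
      by (subst sum.union_disjoint[symmetric]) (auto intro: sum.cong simp: ivl_disj_un)
    ultimately show ?case using Suc by (simp add: field_simps)
  qed
  assume "summable (\<lambda>r. 1 / real (N (\<kappa> (Suc r))))"
  then have "(\<Sum>r<n. 1 / real (N (\<kappa> (Suc r)))) \<le> (\<Sum>r. 1 / real (N (\<kappa> (Suc r))))" for n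
    by (intro sum_le_suminf) auto
  note bound = order_trans[OF partial this]
  obtain k where "2 * (\<Sum>r. 1 / real (N (\<kappa> (Suc r)))) < real k"
    using reals_Archimedean2 by blast
  then show False using bound[of k] by simp
qed

text \<open>Replacing \<open>q\<close> by its residue moves \<open>q * y\<close> by the multiple
  \<open>q div n\<close> of \<open>n * y\<close>, hence by at most \<open>w\<close> modulo 1. This
  is how many targets collapse onto few points.\<close>

lemma nint_dist_residue:
  assumes "nint_dist (of_int q * y - s) \<le> w" "\<bar>q div n\<bar> \<le> M" "of_int M * nint_dist (of_int n * y) \<le> w"
  shows "nint_dist (of_int (q mod n) * y - s) \<le> 2 * w"
proof -
  have "of_int q * y - s = of_int (q div n) * (of_int n * y) + (of_int (q mod n) * y - s)"
    by (subst div_mult_mod_eq[of q n, symmetric]) (simp only: of_int_add of_int_mult algebra_simps)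
  then have "of_int (q mod n) * y - s = (of_int q * y - s) - of_int (q div n) * (of_int n * y)"
    by simp
  then have "nint_dist (of_int (q mod n) * y - s)
      \<le> nint_dist (of_int q * y - s) + nint_dist (of_int (q div n) * (of_int n * y))"
    by (metis nint_dist_triangle_diff)
  also have "nint_dist (of_int (q div n) * (of_int n * y)) \<le> \<bar>of_int (q div n)\<bar> * nint_dist (of_int n * y)"
    by (rule nint_dist_of_int_mult)
  also have "\<dots> \<le> of_int M * nint_dist (of_int n * y)"
    using assms(2) by (intro mult_right_mono) (auto simp flip: of_int_abs)
  finally show ?thesis using assms by linarith
qed

lemma not_Bad_null:
  assumes x: "x \<in> unit_square" "irrational_vec x" "x \<notin> Bad i j"
    and ij: "0 \<le> i" "0 \<le> j" "i + j = 1"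
  obtains \<psi> where "\<psi> \<in> D_set" "W_set i j \<psi> x \<in> null_sets lebesgue"
proof -
  \<comment> \<open>The outer factor \<open>2 ^ k\<close> allows for the quotients by
    \<open>q\<close> of integers up to \<open>2 ^ k * q\<close>; the base of the power becomes the
    value of \<open>\<psi>\<close> on the \<open>k\<close>-th block.\<close>
  define good where "good k q \<longleftrightarrow> q > 0 \<and>
     (i = 0 \<or> 2 ^ k * nint_dist (real q * fst x) \<le> (1 / (2 ^ k * real q)) powr i) \<and>
     (j = 0 \<or> 2 ^ k * nint_dist (real q * snd x) \<le> (1 / (2 ^ k * real q)) powr j)" for k q
  have ex: "\<exists>q\<ge>Q. good k q" for k Q
    unfolding good_def
    by (rule not_Bad_approx_scaled[OF x ij, of "1 / 2 ^ k" "2 ^ k" Q]) (auto simp: mult.commute)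
  \<comment> \<open>Choosing \<open>f\<close> nondecreasing makes \<open>N\<close> at least double
    at each step, which gives the divergence of \<open>\<psi>\<close>.\<close>
  obtain f where f: "\<And>k. good k (f k)" "\<And>k. f k \<le> f (Suc k)"
    using dependent_nat_choice[of good "\<lambda>k q q'. q \<le> q'"] ex by metis
  define N where "N k = 2 ^ k * f k" for k
  have f_pos: "0 < f k" for k using f(1)[of k] by (simp add: good_def)
  have N_pos: "0 < N k" for k using f_pos by (simp add: N_def)
  have N_Suc: "2 * N k \<le> N (Suc k)" for k
    using f(2)[of k] by (simp add: N_def)
  have N_mono: "mono N"
    unfolding mono_iff_le_Suc using N_Suc by (metis le_add1 mult_2 order_trans)
  have N_ge: "k \<le> N k" for k
  proof -
    have "k < 2 ^ k" by (rule less_exp)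
    also have "\<dots> \<le> N k" using f_pos[of k] by (simp add: N_def)
    finally show ?thesis by simp
  qed
  define \<kappa> where "\<kappa> r = (LEAST k. r \<le> N k)" for r
  define \<psi> where "\<psi> r = 1 / real (N (\<kappa> r))" for r
  have \<kappa>: "r \<le> N (\<kappa> r)" for r
    unfolding \<kappa>_def by (rule LeastI[of _ r]) (rule N_ge)
  have \<psi>_pos: "0 < \<psi> r" for r using N_pos by (simp add: \<psi>_def)
  have "mono \<kappa>"
  proof (rule monoI)
    fix r s :: nat assume "r \<le> s"
    then have "r \<le> N (\<kappa> s)" using \<kappa>[of s] by linarith
    then show "\<kappa> r \<le> \<kappa> s" unfolding \<kappa>_def[of r] by (rule Least_le)
  qed
  have "antimono \<psi>"
    using N_pos monoD[OF N_mono monoD[OF \<open>mono \<kappa>\<close>]]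
    by (intro antimonoI) (simp add: \<psi>_def frac_le)
  moreover have "\<not> summable (\<lambda>r. \<psi> (Suc r))"
    unfolding \<psi>_def \<kappa>_def by (rule not_summable_block_reciprocal[of N, OF N_pos N_Suc])
  ultimately have "\<psi> \<in> D_set"
    using \<psi>_pos by (simp add: D_set_def approx_fun_def)
  \<comment> \<open>The radii are doubled because passing from \<open>q\<close> to its residue costs
    one more radius.\<close>
  define w where "w k = 2 * (1 / real (N k)) powr i" for k
  define v where "v k = 2 * (1 / real (N k)) powr j" for k
  define E where "E k b = {s\<in>{0..1}. nint_dist (of_int b * fst x - s) \<le> w k} \<times>
      {s\<in>{0..1}. nint_dist (of_int b * snd x - s) \<le> v k}" for k :: nat and b :: int
  define H where "H k = (\<Union>b\<in>{0..<int (f k)}. E k b)" for k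
  have E_meas [measurable]: "E k b \<in> sets borel" for k b
    unfolding E_def by (intro borel_Times) measurable
  have H_meas [measurable]: "H k \<in> sets borel" for k
    unfolding H_def by measurable
  have E_sub: "E k b \<subseteq> unit_square" for k b
    by (auto simp: E_def unit_square_def)
  have E_fm: "E k b \<in> fmeasurable lborel" for k b
    by (rule fmeasurableI2[OF fmeasurable_unit_square E_sub]) simp
  have "measure lborel (H k) \<le> 16 * (1/2) ^ k" for k
  proof -
    have "measure lborel (H k) \<le> (\<Sum>b\<in>{0..<int (f k)}. measure lborel (E k b))"
      unfolding H_def by (rule measure_UNION_le) auto
    also have "\<dots> \<le> (\<Sum>b\<in>{0..<int (f k)}. 16 / N k)"
    proof (rule sum_mono)
      fix b
      have "measure lborel (E k b) \<le> 4 * w k * v k"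
        unfolding E_def by (rule measure_near_Times_le) (simp_all add: w_def v_def)
      also have "\<dots> = 16 * (1 / real (N k)) powr (i + j)"
        by (simp add: w_def v_def powr_add)
      finally show "measure lborel (E k b) \<le> 16 / N k"
        using ij N_pos[of k] by simp
    qed
    \<comment> \<open>There are \<open>f k\<close> boxes, and
      \<open>N k = 2 ^ k * f k\<close>.\<close>
    also have "\<dots> = 16 * (1/2) ^ k"
      using f_pos[of k] by (simp add: N_def power_one_over)
    finally show ?thesis .
  qed
  then have "summable (\<lambda>k. measure lborel (H k))"
    by (intro summable_comparison_test'[OF summable_mult[OF summable_geometric[of "1/2 :: real"], of 16], of 0]) simp_all
  moreover have "emeasure lborel (H k) < \<infinity>" for k
  proof -
    have "H k \<in> fmeasurable lborel"
      unfolding H_def using E_fm by (intro fmeasurable.finite_UN) auto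
    then show ?thesis by (simp add: fmeasurable_def)
  qed
  ultimately have null: "limsup H \<in> null_sets lborel"
    by (intro borel_cantelli_limsup1) auto
  have "W_set i j \<psi> x \<subseteq> limsup H"
  proof
    fix \<gamma> assume "\<gamma> \<in> W_set i j \<psi> x"
    then have \<gamma>: "\<gamma> \<in> unit_square" "infinite {q::int. q \<noteq> 0 \<and> \<gamma> \<in> target i j x q (\<psi> (nat \<bar>q\<bar>))}" (is "infinite ?Q")
      using W_set_eq[OF ij(1,2) \<psi>_pos] by auto
    have in_H: "\<gamma> \<in> H (\<kappa> (nat \<bar>q\<bar>))" if "q \<in> ?Q" for q
    proof -
      define k where "k = \<kappa> (nat \<bar>q\<bar>)"
      have "\<bar>q\<bar> \<le> 2 ^ k * int (f k)"
        using \<kappa>[of "nat \<bar>q\<bar>"] unfolding k_def[symmetric] N_def by (simp add: nat_le_iff)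
      then have dv: "\<bar>q div int (f k)\<bar> \<le> 2 ^ k"
      proof -
        \<comment> \<open>Rounding down costs nothing for negative \<open>q\<close>, because
          \<open>2 ^ k * int (f k)\<close> is an exact multiple of \<open>int (f k)\<close>.\<close>
        have "- (2 ^ k) \<le> q div int (f k)"
          using \<open>\<bar>q\<bar> \<le> _\<close> f_pos[of k] zdiv_mono1[of "- (2 ^ k * int (f k))" q "int (f k)"]
          by (simp flip: mult_minus_left)
        moreover have "q div int (f k) \<le> 2 ^ k"
          using \<open>\<bar>q\<bar> \<le> _\<close> f_pos[of k] zdiv_mono1[of q "2 ^ k * int (f k)" "int (f k)"] by simp
        ultimately show ?thesis by linarith
      qed
      have \<psi>: "\<psi> (nat \<bar>q\<bar>) = 1 / real (N k)" by (simp add: \<psi>_def k_def)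
      have near: "nint_dist (of_int q * fst x - fst \<gamma>) \<le> (1 / real (N k)) powr i"
        "nint_dist (of_int q * snd x - snd \<gamma>) \<le> (1 / real (N k)) powr j"
        using that by (simp_all add: target_def \<psi>)
      have step: "i = 0 \<or> of_int (2 ^ k) * nint_dist (of_int (int (f k)) * fst x) \<le> (1 / real (N k)) powr i"
        "j = 0 \<or> of_int (2 ^ k) * nint_dist (of_int (int (f k)) * snd x) \<le> (1 / real (N k)) powr j"
        using f(1)[of k] by (auto simp: good_def N_def)
      \<comment> \<open>For an exponent 0 the doubled radius equals 2, so the condition holds
        trivially where \<open>good\<close> gives no information.\<close>
      have two: "nint_dist y \<le> 2" for y using nint_dist_le_half[of y] by linarith
      have "nint_dist (of_int (q mod int (f k)) * fst x - fst \<gamma>) \<le> w k"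
      proof (cases "i = 0")
        case True
        then show ?thesis using two N_pos[of k] by (simp add: w_def)
      next
        case False
        then show ?thesis
          unfolding w_def using step(1) by (intro nint_dist_residue[OF near(1) dv]) blast
      qed
      moreover have "nint_dist (of_int (q mod int (f k)) * snd x - snd \<gamma>) \<le> v k"
      proof (cases "j = 0")
        case True
        then show ?thesis using two N_pos[of k] by (simp add: v_def)
      next
        case False
        then show ?thesis
          unfolding v_def using step(2) by (intro nint_dist_residue[OF near(2) dv]) blast
      qed
      ultimately have "\<gamma> \<in> E k (q mod int (f k))"
        using \<gamma>(1) by (cases \<gamma>) (auto simp: E_def unit_square_def)
      moreover have "q mod int (f k) \<in> {0..<int (f k)}" using f_pos[of k] by simp
      ultimately show ?thesis unfolding H_def k_def by blast
    qed
    \<comment> \<open>Infinitely many integers have unbounded absolute value, so the block index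
      \<open>\<kappa>\<close> is unbounded along the hits of \<open>\<gamma>\<close>.\<close>
    have "\<exists>k\<ge>K. \<gamma> \<in> H k" for K
    proof -
      have "\<exists>q\<in>?Q. \<not> \<bar>q\<bar> \<le> int (N K)"
      proof (rule ccontr)
        assume "\<not> ?thesis"
        then have "?Q \<subseteq> {- int (N K)..int (N K)}" by (fastforce simp: abs_le_iff)
        then show False using \<gamma>(2) finite_subset by blast
      qed
      then obtain q where q: "q \<in> ?Q" "int (N K) < \<bar>q\<bar>" by force
      have "K \<le> \<kappa> (nat \<bar>q\<bar>)"
      proof (rule ccontr)
        assume "\<not> ?thesis"
        then have "N (\<kappa> (nat \<bar>q\<bar>)) \<le> N K" using N_mono by (simp add: monoD)
        then show False using \<kappa>[of "nat \<bar>q\<bar>"] q(2) by linarith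
      qed
      with in_H[OF q(1)] show ?thesis by blast
    qed
    then show "\<gamma> \<in> limsup H" by (force simp: limsup_INF_SUP)
  qed
  moreover have "limsup H \<in> null_sets lebesgue"
    using null by (simp add: null_sets_completionI)
  ultimately have "W_set i j \<psi> x \<in> null_sets lebesgue"
    by (rule null_sets_completion_subset)
  with \<open>\<psi> \<in> D_set\<close> show ?thesis by (rule that)
qed

section \<open>Lower bound for the hits in a box\<close>

text \<open>The library form of Kronecker's theorem is applied to \<open>fst x\<close>,
  \<open>snd x\<close> and 1; rational independence enters as independence in the reals as a module
  over the integers.\<close>

lemma Kronecker_two_dim:
  assumes x: "irrational_vec x" and "e > 0"
  obtains p :: int where "nint_dist (of_int p * fst x - a) < e" "nint_dist (of_int p * snd x - b) < e"
proof -
  define \<theta> where "\<theta> = (\<lambda>k::nat. if k = 0 then fst x else if k = 1 then snd x else 1)"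
  define \<alpha> where "\<alpha> = (\<lambda>k::nat. if k = 0 then a else b)"
  have lin: "k = 0 \<and> l = 0 \<and> m = 0" if "of_int k + of_int l * fst x + of_int m * snd x = 0" for k l m :: int
    using x that unfolding irrational_vec_def
    by (metis of_int_eq_0_iff of_rat_of_int_eq)
  have ne: "fst x \<noteq> snd x" "fst x \<noteq> 1" "snd x \<noteq> 1"
    using lin[of 0 1 "-1"] lin[of "-1" 1 0] lin[of "-1" 0 1] by auto
  interpret Modules.module "\<lambda>r. (*) (real_of_int r)"
    by (simp add: Modules.module.intro distrib_left mult.commute)
  have atMost_2: "{..2::nat} = {0, 1, 2}" by auto
  have image: "\<theta> ` {..2} = {fst x, snd x, 1}"
    by (auto simp: \<theta>_def atMost_2)
  have "independent (\<theta> ` {..2})"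
  proof
    assume "dependent (\<theta> ` {..2})"
    then obtain u v where *: "(\<Sum>v\<in>\<theta> ` {..2}. real_of_int (u v) * v) = 0" "v \<in> \<theta> ` {..2}" "u v \<noteq> 0"
      by (auto simp: dependent_finite)
    then have "of_int (u 1) + of_int (u (fst x)) * fst x + of_int (u (snd x)) * snd x = 0"
      unfolding image using ne by simp
    from lin[OF this] *(2,3) show False unfolding image by auto
  qed
  moreover have "inj_on \<theta> {..2}"
    using ne by (auto simp: inj_on_def \<theta>_def atMost_2)
  moreover have "\<theta> 2 = 1" by (simp add: \<theta>_def)
  ultimately obtain p m where pm: "\<And>k. k < 2 \<Longrightarrow> \<bar>of_int p * \<theta> k - of_int (m k) - \<alpha> k\<bar> < e"
    using Kronecker_thm_2[of \<theta> 2 e \<alpha>] \<open>e > 0\<close> by metis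
  show ?thesis
  proof
    show "nint_dist (of_int p * fst x - a) < e"
      using pm[of 0] nint_dist_le[of "of_int p * fst x - a" "m 0"] by (simp add: \<theta>_def \<alpha>_def algebra_simps)
    show "nint_dist (of_int p * snd x - b) < e"
      using pm[of 1] nint_dist_le[of "of_int p * snd x - b" "m 1"] by (simp add: \<theta>_def \<alpha>_def algebra_simps)
  qed
qed

text \<open>Rounding \<open>y * m\<close> gives a multiple of \<open>1 / m\<close>; reducing it
  modulo \<open>m\<close> changes the point by an integer, which the distance does not see.\<close>

lemma nint_dist_grid:
  assumes "0 < m"
  obtains k where "k < m" "nint_dist (y - real k / real m) \<le> 1 / (2 * real m)"
proof -
  define K where "K = round (y * real m)"
  define k where "k = nat (K mod int m)"
  have k: "int k = K mod int m" using assms by (simp add: k_def)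
  have "real k = real_of_int K - real_of_int (K div int m) * real m"
    by (metis (no_types, opaque_lifting) k minus_div_mult_eq_mod of_int_diff of_int_mult of_int_of_nat_eq)
  then have "y - real k / real m = (y - real_of_int K / real m) + of_int (K div int m)"
    using assms by (simp add: field_simps)
  then have "nint_dist (y - real k / real m) = nint_dist (y - real_of_int K / real m)"
    by (metis nint_dist_add_int)
  also have "\<dots> \<le> \<bar>y - real_of_int K / real m\<bar>"
    using nint_dist_le[of _ 0] by simp
  also have "\<dots> = \<bar>y * real m - real_of_int K\<bar> / real m"
    using assms by (simp add: field_simps)
  also have "\<dots> \<le> (1/2) / real m"
    unfolding K_def using of_int_round_abs_le[of "y * real m"]
    by (intro divide_right_mono) (simp_all add: abs_minus_commute)
  finally show ?thesis
    using assms by (intro that[of k]) (auto simp: k_def nat_less_iff)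
qed

text \<open>Rounding \<open>1 / w\<close> up increases \<open>m * w\<close> by less than
  \<open>w\<close>, hence by less than 1/2. The upper bound limits the number of grid
  points.\<close>

lemma ceiling_grid_size:
  fixes w :: real
  assumes "0 < w" "w \<le> 1/2"
  obtains m :: nat where "0 < m" "1 \<le> real m * w" "real m * w \<le> 3/2"
proof -
  define m where "m = nat \<lceil>1 / w\<rceil>"
  have m: "1 / w \<le> real m" "real m < 1 / w + 1"
    using assms by (simp_all add: m_def) linarith+
  show ?thesis
  proof
    show "1 \<le> real m * w" "real m * w \<le> 3/2"
      using m assms by (simp_all add: field_simps)
    then show "0 < m" by (cases m) auto
  qed
qed

text \<open>Every point lies within half a window of an \<open>m1\<close> by \<open>m2\<close> grid,
  and Kronecker's theorem puts a multiple of \<open>x\<close> within half a window of each grid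
  point. The 9 is \<open>4 * (3/2 * (3/2))\<close>.\<close>

lemma torus_cover:
  assumes x: "irrational_vec x" and w: "0 < w1" "w1 \<le> 1/2" "0 < w2" "w2 \<le> 1/2"
  obtains P :: "nat set" where "finite P" "4 * (w1 * w2) * real (card P) \<le> 9"
    "\<And>s t. \<exists>p\<in>P. nint_dist (s - (c1 + real p * fst x)) < w1 \<and> nint_dist (t - (c2 + real p * snd x)) < w2"
proof -
  obtain m1 :: nat where m1: "0 < m1" "1 \<le> real m1 * w1" "real m1 * w1 \<le> 3/2"
    using ceiling_grid_size w by metis
  obtain m2 :: nat where m2: "0 < m2" "1 \<le> real m2 * w2" "real m2 * w2 \<le> 3/2"
    using ceiling_grid_size w by metis
  have "\<exists>p::int. nint_dist (of_int p * fst x - real k / real m1) < w1 / 2 \<and>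
      nint_dist (of_int p * snd x - real l / real m2) < w2 / 2" for k l :: nat
    by (rule Kronecker_two_dim[OF x, of "min w1 w2 / 2"]) (use w in auto)
  then obtain f :: "nat \<Rightarrow> nat \<Rightarrow> int" where
    f: "\<And>k l. nint_dist (of_int (f k l) * fst x - real k / real m1) < w1 / 2"
       "\<And>k l. nint_dist (of_int (f k l) * snd x - real l / real m2) < w2 / 2"
    by metis
  define I where "I = {..<m1} \<times> {..<m2}"
  define F where "F = (\<lambda>(k, l). f k l)"
  \<comment> \<open>Adding \<open>Q\<close> makes all multipliers nonnegative. It shifts the whole
    grid by \<open>Q\<close> times \<open>x\<close>, which is harmless as every point of the torus
    is covered anyway.\<close>
  define Q where "Q = (\<Sum>z\<in>I. \<bar>F z\<bar>)"
  have "finite I" by (simp add: I_def)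
  have nonneg: "0 \<le> Q + F z" if "z \<in> I" for z
  proof -
    have "\<bar>F z\<bar> \<le> Q"
      unfolding Q_def using that \<open>finite I\<close> by (intro member_le_sum) auto
    then show ?thesis by linarith
  qed
  define P where "P = (\<lambda>z. nat (Q + F z)) ` I"
  show ?thesis
  proof
    show "finite P" unfolding P_def using \<open>finite I\<close> by simp
    have "card P \<le> card I"
      unfolding P_def using \<open>finite I\<close> by (rule card_image_le)
    then have "real (card P) \<le> real m1 * real m2"
      by (simp add: I_def card_cartesian_product flip: of_nat_mult)
    then have "4 * (w1 * w2) * real (card P) \<le> 4 * (w1 * w2) * (real m1 * real m2)"
      using w by (intro mult_left_mono) auto
    also have "\<dots> = 4 * ((real m1 * w1) * (real m2 * w2))" by simp
    also have "\<dots> \<le> 4 * (3/2 * (3/2))"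
      using m1 m2 w by (intro mult_left_mono mult_mono) auto
    finally show "4 * (w1 * w2) * real (card P) \<le> 9" by simp
    fix s t
    obtain k where k: "k < m1" "nint_dist ((s - c1 - of_int Q * fst x) - real k / real m1) \<le> 1 / (2 * real m1)"
      using nint_dist_grid m1(1) by metis
    obtain l where l: "l < m2" "nint_dist ((t - c2 - of_int Q * snd x) - real l / real m2) \<le> 1 / (2 * real m2)"
      using nint_dist_grid m2(1) by metis
    have half: "1 / (2 * real m1) \<le> w1 / 2" "1 / (2 * real m2) \<le> w2 / 2"
      using m1 m2 by (simp_all add: field_simps)
    have "(k, l) \<in> I" using k l by (simp add: I_def)
    define p where "p = nat (Q + f k l)"
    have "p \<in> P" unfolding P_def p_def using \<open>(k, l) \<in> I\<close> by (force simp: F_def)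
    have p: "real p = of_int Q + of_int (f k l)"
      using nonneg[OF \<open>(k, l) \<in> I\<close>] by (simp add: p_def F_def)
    have "nint_dist (s - (c1 + real p * fst x)) < w1"
      using nint_dist_triangle_diff[of "(s - c1 - of_int Q * fst x) - real k / real m1" "of_int (f k l) * fst x - real k / real m1"]
        k(2) f(1)[of k l] half by (simp add: p algebra_simps)
    moreover have "nint_dist (t - (c2 + real p * snd x)) < w2"
      using nint_dist_triangle_diff[of "(t - c2 - of_int Q * snd x) - real l / real m2" "of_int (f k l) * snd x - real l / real m2"]
        l(2) f(2)[of k l] half by (simp add: p algebra_simps)
    ultimately show "\<exists>p\<in>P. nint_dist (s - (c1 + real p * fst x)) < w1 \<and> nint_dist (t - (c2 + real p * snd x)) < w2"
      using \<open>p \<in> P\<close> by blast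
  qed
qed

text \<open>A box on the torus, seen in the unit square. Unlike a \<open>cbox\<close> it may wrap
  around the boundary, so it can be translated by multiples of \<open>x\<close>.\<close>

definition window :: "real \<times> real \<Rightarrow> real \<Rightarrow> real \<Rightarrow> (real \<times> real) set" where
  "window c w1 w2 = {\<gamma> \<in> unit_square. nint_dist (fst \<gamma> - fst c) < w1 \<and> nint_dist (snd \<gamma> - snd c) < w2}"

lemma window_Int_target:
  "window c w1 w2 \<inter> target i j x q t =
     {s\<in>{0..1}. nint_dist (s - fst c) < w1 \<and> nint_dist (of_int q * fst x - s) \<le> t powr i} \<times>
     {s\<in>{0..1}. nint_dist (s - snd c) < w2 \<and> nint_dist (of_int q * snd x - s) \<le> t powr j}"
  by (auto simp: window_def target_def unit_square_def)

text \<open>Translation by \<open>p\<close> times \<open>x\<close> carries the target of index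
  \<open>q\<close> to that of index \<open>q + p\<close> with the same radius parameter
  \<open>t\<close>.\<close>

lemma measure_window_target_shift:
  "measure lborel (window (fst c + of_int p * fst x, snd c + of_int p * snd x) w1 w2 \<inter> target i j x (q + p) t) =
   measure lborel (window c w1 w2 \<inter> target i j x q t)"
  unfolding window_Int_target
  using measure_nint_dist_shift[of "fst c" "of_int p * fst x" w1 "of_int q * fst x"]
    measure_nint_dist_shift[of "snd c" "of_int p * snd x" w2 "of_int q * snd x"]
  by (simp add: measure_lborel_Times distrib_right)

lemma sets_window [measurable]: "window c w1 w2 \<in> sets borel"
proof -
  have "window c w1 w2 = {s\<in>{0..1}. nint_dist (s - fst c) < w1} \<times> {s\<in>{0..1}. nint_dist (s - snd c) < w2}"
    by (auto simp: window_def unit_square_def)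
  also have "\<dots> \<in> sets borel" by (intro borel_Times) measurable
  finally show ?thesis .
qed

text \<open>A nonzero nearest integer would push \<open>s\<close> out of the unit interval.
  Strictness matters: with equality allowed, \<open>s = 1\<close> would count as near an interval
  starting at 0.\<close>

lemma window_near_interval:
  fixes s :: real
  assumes "0 \<le> a" "b \<le> 1" "0 \<le> s" "s \<le> 1" "nint_dist (s - (a + b) / 2) < (b - a) / 2"
  shows "a \<le> s \<and> s \<le> b"
proof -
  define m where "m = round (s - (a + b) / 2)"
  have lt: "\<bar>s - (a + b) / 2 - of_int m\<bar> < (b - a) / 2"
    using assms(5) by (simp add: nint_dist_def m_def)
  consider "m = 0" | "m \<ge> 1" | "m \<le> -1" by linarith
  then show ?thesis
  proof cases
    case 2
    then have "real_of_int m \<ge> 1" by linarith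
    with lt assms show ?thesis by (simp add: abs_if field_simps split: if_splits)
  next
    case 3
    then have "real_of_int m \<le> -1" by linarith
    with lt assms show ?thesis by (simp add: abs_if field_simps split: if_splits)
  qed (use lt in \<open>auto simp: abs_if field_simps split: if_splits\<close>)
qed

lemma window_subset_cbox:
  assumes "0 \<le> a1" "b1 \<le> 1" "0 \<le> a2" "b2 \<le> 1"
  shows "window ((a1 + b1) / 2, (a2 + b2) / 2) ((b1 - a1) / 2) ((b2 - a2) / 2) \<subseteq> cbox (a1, a2) (b1, b2)"
  using window_near_interval[of a1 b1] window_near_interval[of a2 b2] assms
  by (auto simp: window_def unit_square_def)

text \<open>The first \<open>p\<close> terms are at most 1 each. A later term of index
  \<open>q + p\<close> is translated back to index \<open>q\<close>, where the target is at least as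
  large since \<open>\<phi>\<close> does not increase.\<close>

lemma sum_measure_window_le:
  fixes \<phi> :: "nat \<Rightarrow> real" and p :: nat
  assumes ij: "0 \<le> i" "0 \<le> j" and \<phi>: "\<And>q. 0 < \<phi> q" "antimono \<phi>"
  shows "(\<Sum>q=1..n. measure lborel (window (fst c + real p * fst x, snd c + real p * snd x) w1 w2 \<inter> target i j x (int q) (\<phi> q)))
     \<le> real p + (\<Sum>q=1..n. measure lborel (window c w1 w2 \<inter> target i j x (int q) (\<phi> q)))"
proof -
  define f where "f q = measure lborel (window (fst c + real p * fst x, snd c + real p * snd x) w1 w2 \<inter> target i j x (int q) (\<phi> q))" for q
  define g where "g q = measure lborel (window c w1 w2 \<inter> target i j x (int q) (\<phi> q))" for q
  have fm: "window c w1 w2 \<inter> target i j x q t \<in> fmeasurable lborel" for c q t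
    by (rule fmeasurableI2[OF fmeasurable_target]) auto
  have nonneg: "0 \<le> f q" "0 \<le> g q" for q by (simp_all add: f_def g_def)
  have f1: "f q \<le> 1" for q
    unfolding f_def measure_unit_square[symmetric]
    by (rule measure_mono_fmeasurable[OF _ _ fmeasurable_unit_square]) (use target_subset[of i j x "int q" "\<phi> q"] in auto)
  have fg: "f (q + p) \<le> g q" for q
  proof -
    have "f (q + p) = measure lborel (window c w1 w2 \<inter> target i j x (int q) (\<phi> (q + p)))"
      unfolding f_def using measure_window_target_shift[of c "int p" x w1 w2 i j "int q"] by simp
    also have "\<dots> \<le> g q"
      unfolding g_def
      by (rule measure_mono_fmeasurable[OF _ _ fm])
        (use target_mono[OF ij, of "\<phi> (q + p)" "\<phi> q" x "int q"] \<phi>(1)[of "q + p"] antimonoD[OF \<phi>(2), of q "q + p"] in auto)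
    finally show ?thesis .
  qed
  have "(\<Sum>q=1..n. f q) \<le> (\<Sum>q\<in>{1..p} \<union> (\<lambda>q. q + p) ` {1..n}. f q)"
  proof (rule sum_mono2)
    show "{1..n} \<subseteq> {1..p} \<union> (\<lambda>q. q + p) ` {1..n}"
    proof
      fix q assume "q \<in> {1..n}"
      then show "q \<in> {1..p} \<union> (\<lambda>q. q + p) ` {1..n}"
        by (cases "q \<le> p") (auto intro!: image_eqI[of _ _ "q - p"])
    qed
  qed (use nonneg in auto)
  also have "\<dots> = (\<Sum>q=1..p. f q) + (\<Sum>q=1..n. f (q + p))"
    using sum.shift_bounds_cl_nat_ivl[of f 1 p n]
    by (subst sum.union_disjoint) auto
  also have "\<dots> \<le> (\<Sum>q=1..p. 1) + (\<Sum>q=1..n. g q)"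
    by (intro add_mono sum_mono f1 fg)
  finally show ?thesis by (simp add: f_def g_def)
qed

text \<open>Finitely many translates of the window inscribed in the box cover every target, and all
  translates are hit equally often up to a constant. The bound on their number gives the factor
  1/9.\<close>

lemma sum_measure_box_ge:
  fixes \<phi> :: "nat \<Rightarrow> real"
  assumes ij: "0 \<le> i" "0 \<le> j" "i + j = 1" and x: "irrational_vec x"
    and \<phi>: "\<And>q. 0 < \<phi> q" "\<And>q. \<phi> q \<le> 1" "antimono \<phi>" and "cbox u v \<subseteq> unit_square"
  shows "\<exists>C. \<forall>n. measure lborel (cbox u v) / 9 * (\<Sum>q=1..n. \<phi> q)
     \<le> C + (\<Sum>q=1..n. measure lborel (cbox u v \<inter> target i j x (int q) (\<phi> q)))"
proof (cases "fst u < fst v \<and> snd u < snd v")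
  case False
  then have "measure lborel (cbox u v) = 0"
    by (cases u; cases v) (auto simp: cbox_Pair_eq measure_lborel_Times)
  then show ?thesis by (intro exI[of _ 0]) (simp add: sum_nonneg)
next
  case True
  obtain a1 a2 b1 b2 where uv: "u = (a1, a2)" "v = (b1, b2)" by (cases u, cases v)
  have ab: "a1 < b1" "a2 < b2" using True uv by auto
  have "(a1, a2) \<in> unit_square" "(b1, b2) \<in> unit_square"
    using assms(8) ab by (auto simp: uv)
  then have bounds: "0 \<le> a1" "b1 \<le> 1" "0 \<le> a2" "b2 \<le> 1"
    by (auto simp: unit_square_def)
  define w1 where "w1 = (b1 - a1) / 2"
  define w2 where "w2 = (b2 - a2) / 2"
  define c where "c = ((a1 + b1) / 2, (a2 + b2) / 2)"
  define W where "W p = window (fst c + real p * fst x, snd c + real p * snd x) w1 w2" for p :: nat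
  define T where "T q = target i j x (int q) (\<phi> q)" for q :: nat
  define B where "B = cbox u v"
  have \<mu>B: "measure lborel B = 4 * (w1 * w2)" "0 < measure lborel B"
    using ab by (simp_all add: B_def uv cbox_Pair_eq measure_lborel_Times w1_def w2_def)
  have T_fm: "T q \<in> fmeasurable lborel" for q unfolding T_def by (rule fmeasurable_target)
  obtain P where P: "finite P" "4 * (w1 * w2) * real (card P) \<le> 9"
    "\<And>s t. \<exists>p\<in>P. nint_dist (s - (fst c + real p * fst x)) < w1 \<and> nint_dist (t - (snd c + real p * snd x)) < w2"
    using torus_cover[OF x, of w1 w2 "fst c" "snd c"] ab bounds by (auto simp: w1_def w2_def)
  have "\<phi> q \<le> (\<Sum>p\<in>P. measure lborel (W p \<inter> T q))" for q
  proof -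
    have "\<phi> q \<le> measure lborel (T q)"
      unfolding T_def using ij \<phi> by (intro measure_target_ge) auto
    also have "T q = (\<Union>p\<in>P. W p \<inter> T q)"
      using P(3) target_subset by (fastforce simp: W_def T_def window_def)
    also have "measure lborel \<dots> \<le> (\<Sum>p\<in>P. measure lborel (W p \<inter> T q))"
      using P(1) by (intro measure_UNION_le) (auto simp: W_def T_def)
    finally show ?thesis .
  qed
  then have "(\<Sum>q=1..n. \<phi> q) \<le> (\<Sum>q=1..n. \<Sum>p\<in>P. measure lborel (W p \<inter> T q))" for n
    by (rule sum_mono)
  also have "(\<Sum>q=1..n. \<Sum>p\<in>P. measure lborel (W p \<inter> T q)) = (\<Sum>p\<in>P. \<Sum>q=1..n. measure lborel (W p \<inter> T q))" for n
    by (rule sum.swap)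
  also have "(\<Sum>p\<in>P. \<Sum>q=1..n. measure lborel (W p \<inter> T q)) \<le> (\<Sum>p\<in>P. real p + (\<Sum>q=1..n. measure lborel (window c w1 w2 \<inter> T q)))" for n
    unfolding W_def T_def using ij \<phi> by (intro sum_mono sum_measure_window_le) auto
  also have "(\<Sum>p\<in>P. real p + (\<Sum>q=1..n. measure lborel (window c w1 w2 \<inter> T q)))
      \<le> (\<Sum>p\<in>P. real p + (\<Sum>q=1..n. measure lborel (B \<inter> T q)))" for n
  proof (intro sum_mono add_left_mono)
    fix q
    show "measure lborel (window c w1 w2 \<inter> T q) \<le> measure lborel (B \<inter> T q)"
      using window_subset_cbox[OF bounds]
      by (intro measure_mono_fmeasurable fmeasurable_Int_fmeasurable[OF _ ] fmeasurableI2[OF T_fm[of q]])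
        (auto simp: T_def B_def c_def w1_def w2_def uv)
  qed
  finally have main: "(\<Sum>q=1..n. \<phi> q) \<le> real (\<Sum>P) + real (card P) * (\<Sum>q=1..n. measure lborel (B \<inter> T q))" for n
    by (simp add: sum.distrib)
  have "measure lborel B / 9 * (\<Sum>q=1..n. \<phi> q)
      \<le> measure lborel B / 9 * real (\<Sum>P) + (\<Sum>q=1..n. measure lborel (B \<inter> T q))" for n
  proof -
    have "measure lborel B / 9 * (\<Sum>q=1..n. \<phi> q)
      \<le> measure lborel B / 9 * (real (\<Sum>P) + real (card P) * (\<Sum>q=1..n. measure lborel (B \<inter> T q)))"
      using main by (intro mult_left_mono) auto
    also have "\<dots> = measure lborel B / 9 * real (\<Sum>P) + (measure lborel B * real (card P) / 9) * (\<Sum>q=1..n. measure lborel (B \<inter> T q))"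
      by (simp add: field_simps)
    \<comment> \<open>The measure of \<open>B\<close> is \<open>4 * (w1 * w2)\<close>, so the bound
      on \<open>card P\<close> makes the coefficient at most 1.\<close>
    also have "\<dots> \<le> measure lborel B / 9 * real (\<Sum>P) + 1 * (\<Sum>q=1..n. measure lborel (B \<inter> T q))"
      using P(2) \<mu>B by (intro add_left_mono mult_right_mono sum_nonneg) auto
    finally show ?thesis by simp
  qed
  then show ?thesis unfolding B_def T_def by blast
qed

section \<open>Second moment\<close>

text \<open>Each \<open>r\<close> in \<open>T\<close> owns the \<open>M\<close> consecutive integers
  ending at \<open>r\<close>, on which \<open>g\<close> is at least \<open>g r\<close>. Separation
  makes these blocks disjoint.\<close>

lemma sum_separated_le:
  fixes g :: "nat \<Rightarrow> real" and M :: nat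
  assumes "T \<subseteq> {1..n}" and M: "\<And>r. r \<in> T \<Longrightarrow> M \<le> r"
    and sep: "\<And>r s. r \<in> T \<Longrightarrow> s \<in> T \<Longrightarrow> r < s \<Longrightarrow> r + M \<le> s"
    and g: "antimono g" "\<And>r. 0 \<le> g r"
  shows "real M * sum g T \<le> sum g {1..n}"
proof -
  have "finite T" using assms(1) finite_subset by blast
  define J where "J r = {Suc (r - M)..r}" for r
  have "real M * sum g T = (\<Sum>r\<in>T. real M * g r)" by (simp add: sum_distrib_left)
  also have "\<dots> \<le> (\<Sum>r\<in>T. sum g (J r))"
  proof (rule sum_mono)
    fix r assume "r \<in> T"
    then have "card (J r) = M" using M by (simp add: J_def)
    then have "real M * g r = (\<Sum>s\<in>J r. g r)" by simp
    also have "\<dots> \<le> sum g (J r)"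
      using g(1) by (intro sum_mono) (auto simp: J_def antimono_def)
    finally show "real M * g r \<le> sum g (J r)" .
  qed
  also have "\<dots> = sum g (\<Union>r\<in>T. J r)"
  proof (rule sum.UNION_disjoint[symmetric])
    show "\<forall>r\<in>T. \<forall>s\<in>T. r \<noteq> s \<longrightarrow> J r \<inter> J s = {}"
    proof (intro ballI impI)
      have "J r \<inter> J s = {}" if "r \<in> T" "s \<in> T" "r < s" for r s
        using sep[OF that] by (auto simp: J_def)
      then show "J r \<inter> J s = {}" if "r \<in> T" "s \<in> T" "r \<noteq> s" for r s
        using that by (metis inf_commute linorder_neqE_nat)
    qed
  qed (use \<open>finite T\<close> in \<open>auto simp: J_def\<close>)
  also have "\<dots> \<le> sum g {1..n}"
    using assms(1) g(2) by (intro sum_mono2) (auto simp: J_def)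
  finally show ?thesis .
qed

text \<open>The factor 4 is absorbed by enlarging \<open>t\<close> to \<open>K * t\<close>. One
  factor 2 comes from a point common to two targets, another from subtracting two such index
  differences.\<close>

lemma Bad_separation:
  assumes "x \<in> Bad i j" and ij: "0 \<le> i" "0 \<le> j" "i + j = 1"
  obtains \<delta> where "0 < \<delta>"
    "\<And>d t. d > 0 \<Longrightarrow> 0 < t \<Longrightarrow> nint_dist (real d * fst x) \<le> 4 * t powr i \<Longrightarrow>
       nint_dist (real d * snd x) \<le> 4 * t powr j \<Longrightarrow> \<delta> < real d * t"
proof -
  obtain c where c: "0 < c" "\<And>q. q \<ge> 1 \<Longrightarrow> c / real q < approx_error i j x q"
    using assms(1) unfolding Bad_def approx_error_def by auto
  \<comment> \<open>For an exponent 0 division by zero gives \<open>4 powr 0 = 1\<close>; that case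
    of \<open>absorb\<close> rests on distances being at most 1/2.\<close>
  define K :: real where "K = max (4 powr (1 / i)) (4 powr (1 / j))"
  have K: "4 powr (1 / i) \<le> K" "4 powr (1 / j) \<le> K" "0 < K" by (auto simp: K_def less_max_iff_disj)
  have absorb: "nint_dist y \<le> (K * t) powr h"
    if "nint_dist y \<le> 4 * t powr h" "0 < t" "0 \<le> h" "4 powr (1 / h) \<le> K" for y t h
  proof (cases "h = 0")
    case True
    then show ?thesis using nint_dist_le_half[of y] that K by simp
  next
    case False
    have "4 = (4 powr (1 / h)) powr h" using False by (simp add: powr_powr)
    also have "\<dots> \<le> K powr h" using that by (intro powr_mono2) auto
    finally have "4 * t powr h \<le> K powr h * t powr h" by (intro mult_right_mono) auto
    also have "\<dots> = (K * t) powr h" using that K by (simp add: powr_mult)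
    finally show ?thesis using that(1) by linarith
  qed
  show ?thesis
  proof
    show "0 < c / K" using c K by simp
    fix d :: nat and t :: real
    assume d: "d > 0" "0 < t" "nint_dist (real d * fst x) \<le> 4 * t powr i" "nint_dist (real d * snd x) \<le> 4 * t powr j"
    then have "approx_error i j x d \<le> K * t"
      using absorb ij K by (simp add: approx_error_le_iff)
    with c(2)[of d] d have "c / real d < K * t" by linarith
    then show "c / K < real d * t"
      using d K by (simp add: field_simps)
  qed
qed

lemma target_diff_near:
  assumes "\<gamma> \<in> target i j x p s" "\<gamma> \<in> target i j x q t" "0 < t" "t \<le> s" "0 \<le> i" "0 \<le> j"
  shows "nint_dist (of_int (q - p) * fst x) \<le> 2 * s powr i"
    "nint_dist (of_int (q - p) * snd x) \<le> 2 * s powr j"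
proof -
  have "t powr i \<le> s powr i" "t powr j \<le> s powr j"
    using assms by (auto intro: powr_mono2)
  moreover have "of_int (q - p) * y = (of_int q * y - z) - (of_int p * y - z)" for y z :: real
    by (simp add: left_diff_distrib)
  ultimately show "nint_dist (of_int (q - p) * fst x) \<le> 2 * s powr i"
    "nint_dist (of_int (q - p) * snd x) \<le> 2 * s powr j"
    using assms(1,2) nint_dist_triangle_diff[of "of_int q * fst x - fst \<gamma>" "of_int p * fst x - fst \<gamma>"]
      nint_dist_triangle_diff[of "of_int q * snd x - snd \<gamma>" "of_int p * snd x - snd \<gamma>"]
    by (fastforce simp: target_def)+
qed

lemma sum_symmetric_eq:
  fixes a :: "nat \<Rightarrow> nat \<Rightarrow> real"
  assumes "\<And>p q. a p q = a q p"
  shows "(\<Sum>p=1..n. \<Sum>q=1..n. a p q) = (\<Sum>p=1..n. a p p) + 2 * (\<Sum>p=1..n. \<Sum>q\<in>{p<..n}. a p q)"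
proof -
  have "(\<Sum>q=1..n. a p q) = a p p + (\<Sum>q\<in>{p<..n}. a p q) + (\<Sum>q\<in>{1..<p}. a p q)" if "p \<in> {1..n}" for p
  proof -
    have "{1..n} = insert p ({p<..n} \<union> {1..<p})" using that by auto
    moreover have "{p<..n} \<inter> {1..<p} = {}" by auto
    ultimately show ?thesis by (simp add: sum.union_disjoint)
  qed
  then have "(\<Sum>p=1..n. \<Sum>q=1..n. a p q) =
      (\<Sum>p=1..n. a p p) + (\<Sum>p=1..n. \<Sum>q\<in>{p<..n}. a p q) + (\<Sum>p=1..n. \<Sum>q\<in>{1..<p}. a p q)"
    by (simp add: sum.distrib)
  also have "(\<Sum>p=1..n. \<Sum>q\<in>{1..<p}. a p q) = (\<Sum>p=1..n. \<Sum>q\<in>{q\<in>{1..n}. q < p}. a p q)"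
    by (intro sum.cong) auto
  also have "\<dots> = (\<Sum>q=1..n. \<Sum>p\<in>{p\<in>{1..n}. q < p}. a p q)"
    by (rule sum.swap_restrict) auto
  also have "\<dots> = (\<Sum>p=1..n. \<Sum>q\<in>{p<..n}. a p q)"
    using assms by (intro sum.cong) auto
  finally show ?thesis by simp
qed

text \<open>Quasi-independence on average. For fixed \<open>p\<close>, separation bounds the sum
  over later targets meeting \<open>T p\<close> by a constant times \<open>\<phi> p * S\<close>;
  summing over \<open>p\<close> gives \<open>S\<^sup>2\<close>.\<close>

lemma sum_measure_pairs_le:
  fixes \<phi> :: "nat \<Rightarrow> real"
  assumes x: "x \<in> Bad i j" and ij: "0 \<le> i" "0 \<le> j" "i + j = 1"
    and \<phi>: "\<And>q. 0 < \<phi> q" "antimono \<phi>"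
  obtains C where "0 < C"
    "\<And>n. 1 \<le> (\<Sum>q=1..n. \<phi> q) \<Longrightarrow>
       (\<Sum>p=1..n. \<Sum>q=1..n. measure lborel (target i j x (int p) (\<phi> p) \<inter> target i j x (int q) (\<phi> q)))
         \<le> C * (\<Sum>q=1..n. \<phi> q)\<^sup>2"
proof -
  obtain \<delta> where \<delta>: "0 < \<delta>"
    "\<And>d t. d > 0 \<Longrightarrow> 0 < t \<Longrightarrow> nint_dist (real d * fst x) \<le> 4 * t powr i \<Longrightarrow>
       nint_dist (real d * snd x) \<le> 4 * t powr j \<Longrightarrow> \<delta> < real d * t"
    by (rule Bad_separation[OF x ij]) blast
  show ?thesis
  proof
    show "0 < 4 + 8 / \<delta>" using \<delta>(1) by (simp add: add_pos_pos)
    fix n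
    assume S1: "1 \<le> (\<Sum>q=1..n. \<phi> q)"
    define S where "S = (\<Sum>q=1..n. \<phi> q)"
    define T where "T q = target i j x (int q) (\<phi> q)" for q
    have \<mu>T: "measure lborel (T q) \<le> 4 * \<phi> q" for q
      unfolding T_def using measure_target_le ij \<phi> by simp
    have \<mu>TT: "measure lborel (T p \<inter> T q) \<le> 4 * \<phi> q" for p q
      by (rule order_trans[OF measure_mono_fmeasurable \<mu>T])
        (auto simp: T_def intro: fmeasurable_target)
    have tail: "(\<Sum>q\<in>{p<..n}. measure lborel (T p \<inter> T q)) \<le> 4 / \<delta> * \<phi> p * S" if "p \<in> {1..n}" for p
    proof -
      define R where "R = {r\<in>{1..n - p}. T p \<inter> T (p + r) \<noteq> {}}"
      define M where "M = nat \<lceil>\<delta> / \<phi> p\<rceil>"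
      have M: "0 < M" "\<delta> / \<phi> p \<le> real M"
        using \<delta>(1) \<phi>(1)[of p] by (simp_all add: M_def)
      have near: "nint_dist (real r * fst x) \<le> 2 * \<phi> p powr i \<and> nint_dist (real r * snd x) \<le> 2 * \<phi> p powr j"
        if "r \<in> R" for r
      proof -
        obtain \<gamma> where "\<gamma> \<in> T p" "\<gamma> \<in> T (p + r)" using \<open>r \<in> R\<close> by (auto simp: R_def)
        then show ?thesis
          using target_diff_near[of \<gamma> i j x "int p" "\<phi> p" "int (p + r)" "\<phi> (p + r)"] ij \<phi>(1)
            antimonoD[OF \<phi>(2), of p "p + r"] by (simp add: T_def)
      qed
      \<comment> \<open>The factor 4 serves two uses: offsets in \<open>R\<close> satisfy the bounds
        with 2, differences of two offsets only with 4.\<close>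
      have gap: "M \<le> d" if "d > 0" "nint_dist (real d * fst x) \<le> 4 * \<phi> p powr i"
        "nint_dist (real d * snd x) \<le> 4 * \<phi> p powr j" for d
      proof -
        have "\<delta> / \<phi> p < real d" using \<delta>(2)[OF that(1) \<phi>(1) that(2,3)] \<phi>(1)[of p] by (simp add: field_simps)
        then show ?thesis unfolding M_def by (simp add: ceiling_le_iff nat_le_iff)
      qed
      have "real M * (\<Sum>r\<in>R. \<phi> (p + r)) \<le> (\<Sum>r=1..n - p. \<phi> (p + r))"
      proof (rule sum_separated_le)
        show "R \<subseteq> {1..n - p}" by (auto simp: R_def)
        show "M \<le> r" if "r \<in> R" for r
        proof (rule gap)
          show "r > 0" using that by (simp add: R_def)
        qed (use near[OF that] powr_ge_zero[of "\<phi> p" i] powr_ge_zero[of "\<phi> p" j] in linarith)+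
        show "r + M \<le> s" if "r \<in> R" "s \<in> R" "r < s" for r s
        proof -
          have "real (s - r) * y = real s * y - real r * y" for y
            using that(3) by (simp add: of_nat_diff left_diff_distrib)
          then have "M \<le> s - r"
            using near[OF that(1)] near[OF that(2)] that(3)
              nint_dist_triangle_diff[of "real s * fst x" "real r * fst x"]
              nint_dist_triangle_diff[of "real s * snd x" "real r * snd x"]
            by (intro gap) auto
          then show ?thesis using that(3) by simp
        qed
        show "antimono (\<lambda>r. \<phi> (p + r))" using \<phi>(2) by (auto simp: antimono_def)
        show "0 \<le> \<phi> (p + r)" for r using \<phi>(1) by (rule less_imp_le)
      qed
      also have "\<dots> = (\<Sum>q\<in>(+) p ` {1..n - p}. \<phi> q)" by (subst sum.reindex) simp_all
      also have "\<dots> \<le> S"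
        unfolding S_def using \<phi>(1) that by (intro sum_mono2) (auto simp: less_imp_le)
      finally have "real M * (\<Sum>r\<in>R. \<phi> (p + r)) \<le> S" .
      moreover have "\<delta> / \<phi> p * (\<Sum>r\<in>R. \<phi> (p + r)) \<le> real M * (\<Sum>r\<in>R. \<phi> (p + r))"
        using M(2) \<phi>(1) by (intro mult_right_mono sum_nonneg) (auto simp: less_imp_le)
      ultimately have "\<delta> / \<phi> p * (\<Sum>r\<in>R. \<phi> (p + r)) \<le> S" by linarith
      then have R_sum: "(\<Sum>r\<in>R. \<phi> (p + r)) \<le> \<phi> p * S / \<delta>"
        using \<delta>(1) \<phi>(1)[of p] by (simp add: field_simps)
      have "{p<..n} = (+) p ` {1..n - p}"
        using that by auto
      moreover have "sum f ((+) p ` {1..n - p}) = (\<Sum>r=1..n - p. f (p + r))" for f :: "nat \<Rightarrow> real"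
        by (subst sum.reindex) simp_all
      ultimately have "(\<Sum>q\<in>{p<..n}. measure lborel (T p \<inter> T q)) = (\<Sum>r=1..n - p. measure lborel (T p \<inter> T (p + r)))"
        by simp
      also have "\<dots> = (\<Sum>r\<in>R. measure lborel (T p \<inter> T (p + r)))"
        by (intro sum.mono_neutral_right) (auto simp: R_def)
      also have "\<dots> \<le> (\<Sum>r\<in>R. 4 * \<phi> (p + r))" by (intro sum_mono \<mu>TT)
      also have "\<dots> \<le> 4 / \<delta> * \<phi> p * S"
        using R_sum by (simp flip: sum_distrib_left)
      finally show ?thesis .
    qed
    have "(\<Sum>p=1..n. \<Sum>q=1..n. measure lborel (T p \<inter> T q)) =
        (\<Sum>p=1..n. measure lborel (T p \<inter> T p)) + 2 * (\<Sum>p=1..n. \<Sum>q\<in>{p<..n}. measure lborel (T p \<inter> T q))"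
      by (rule sum_symmetric_eq) (simp add: Int_commute)
    also have "\<dots> \<le> (\<Sum>p=1..n. 4 * \<phi> p) + 2 * (\<Sum>p=1..n. 4 / \<delta> * \<phi> p * S)"
      by (intro add_mono mult_left_mono sum_mono \<mu>TT tail) auto
    also have "(\<Sum>p=1..n. 4 / \<delta> * \<phi> p * S) = S * (4 / \<delta> * S)"
      unfolding S_def by (subst sum_distrib_right) (simp add: mult_ac)
    also have "(\<Sum>p=1..n. 4 * \<phi> p) = 4 * S"
      unfolding S_def by (rule sum_distrib_left[symmetric])
    also have "4 * S + 2 * (S * (4 / \<delta> * S)) = 4 * S + 8 / \<delta> * S\<^sup>2"
      by (simp add: power2_eq_square)
    \<comment> \<open>The diagonal is linear in \<open>S\<close>; it is absorbed because
      \<open>1 \<le> S\<close>.\<close>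
    also have "\<dots> \<le> (4 + 8 / \<delta>) * S\<^sup>2"
      using S1 self_le_power[of S 2] by (simp add: S_def distrib_right)
    finally show "(\<Sum>p=1..n. \<Sum>q=1..n. measure lborel (target i j x (int p) (\<phi> p) \<inter> target i j x (int q) (\<phi> q)))
         \<le> (4 + 8 / \<delta>) * (\<Sum>q=1..n. \<phi> q)\<^sup>2"
      unfolding S_def T_def .
  qed
qed

section \<open>Full measure\<close>

text \<open>Cauchy--Schwarz for the counting function on \<open>V\<close> in additive form; the free
  weight \<open>b\<close> takes the place of the square root of the product.\<close>

lemma sum_measure_Int_le:
  assumes V: "V \<in> fmeasurable M" and T: "\<And>q. q \<in> I \<Longrightarrow> T q \<in> fmeasurable M"
    and "finite I" "0 < b"
  shows "(\<Sum>q\<in>I. measure M (V \<inter> T q)) \<le> b * (\<Sum>p\<in>I. \<Sum>q\<in>I. measure M (T p \<inter> T q)) + measure M V / b"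
proof -
  define f :: "'a \<Rightarrow> real" where "f z = (\<Sum>q\<in>I. indicator (T q) z)" for z
  have int: "integrable M (indicator A :: 'a \<Rightarrow> real)" "(\<integral>z. indicator A z \<partial>M) = measure M A"
    if "A \<in> fmeasurable M" for A
    using that by (auto simp: fmeasurable_def Int_absorb2[OF sets.sets_into_space])
  have VT: "V \<inter> T q \<in> fmeasurable M" "p \<in> I \<Longrightarrow> T p \<inter> T q \<in> fmeasurable M" if "q \<in> I" for p q
    using V T that by auto
  have le: "indicator V z * f z \<le> b * (f z)\<^sup>2 + indicator V z / b" for z
  proof (cases "z \<in> V")
    case True
    \<comment> \<open>AM--GM: \<open>2 f \<le> b f\<^sup>2 + 1 / b\<close>\<close>
    have "0 \<le> f z" by (simp add: f_def sum_nonneg)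
    have "0 \<le> (b * f z - 1)\<^sup>2 / b" using \<open>0 < b\<close> by simp
    also have "\<dots> = b * (f z)\<^sup>2 + 1 / b - 2 * f z"
      using \<open>0 < b\<close> by (simp add: power2_eq_square field_simps)
    finally show ?thesis using True \<open>0 \<le> f z\<close> by simp
  qed (use \<open>0 < b\<close> in simp)
  have Vf: "(\<lambda>z. indicator V z * f z) = (\<lambda>z. \<Sum>q\<in>I. indicator (V \<inter> T q) z)"
    by (auto simp: f_def sum_distrib_left indicator_inter_arith)
  have ff: "(\<lambda>z. (f z)\<^sup>2) = (\<lambda>z. \<Sum>p\<in>I. \<Sum>q\<in>I. indicator (T p \<inter> T q) z)"
    by (auto simp: f_def power2_eq_square sum_product indicator_inter_arith)
  have i1: "integrable M (\<lambda>z. indicator V z * f z)"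
    and e1: "(\<integral>z. indicator V z * f z \<partial>M) = (\<Sum>q\<in>I. measure M (V \<inter> T q))"
    unfolding Vf using VT int by simp_all
  have i2: "integrable M (\<lambda>z. (f z)\<^sup>2)"
    and e2: "(\<integral>z. (f z)\<^sup>2 \<partial>M) = (\<Sum>p\<in>I. \<Sum>q\<in>I. measure M (T p \<inter> T q))"
    unfolding ff using VT int by simp_all
  have "(\<integral>z. indicator V z * f z \<partial>M) \<le> (\<integral>z. b * (f z)\<^sup>2 + indicator V z / b \<partial>M)"
    using i1 i2 int(1)[OF V] le by (intro integral_mono) auto
  also have "\<dots> = b * (\<integral>z. (f z)\<^sup>2 \<partial>M) + measure M V / b"
    using i2 int[OF V] by simp
  finally show ?thesis unfolding e1 e2 .
qed

text \<open>A countable cover by nonoverlapping boxes with small excess is truncated by continuity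
  from below. Finiteness matters later, when one additive constant per box is summed.\<close>

lemma measurable_finite_boxes_approx:
  fixes S :: "'a::euclidean_space set"
  assumes S: "S \<in> lmeasurable" "S \<subseteq> cbox a b" and "0 < e" "s < measure lebesgue S"
  obtains F where "finite F" "\<And>K. K \<in> F \<Longrightarrow> K \<subseteq> cbox a b \<and> (\<exists>c d. K = cbox c d)"
    "pairwise (\<lambda>K L. negligible (K \<inter> L)) F" "s < measure lebesgue (\<Union>F)"
    "measure lebesgue (\<Union>F - S) \<le> e"
proof -
  obtain D where D: "countable D" "\<And>K. K \<in> D \<Longrightarrow> K \<subseteq> cbox a b \<and> K \<noteq> {} \<and> (\<exists>c d. K = cbox c d)"
    "pairwise (\<lambda>A B. interior A \<inter> interior B = {}) D" "S \<subseteq> \<Union>D" "\<Union>D \<in> lmeasurable"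
    "measure lebesgue (\<Union>D) \<le> measure lebesgue S + e"
    using measurable_outer_intervals_bounded[OF S \<open>0 < e\<close>] by metis
  have negl: "negligible (K \<inter> L)" if KL: "K \<in> D" "L \<in> D" "K \<noteq> L" for K L
  proof -
    have "interior K \<inter> interior L = {}" using D(3) that by (auto simp: pairwise_def)
    moreover obtain u v x y where "K = cbox u v" "L = cbox x y" using D(2)[OF KL(1)] D(2)[OF KL(2)] by blast
    ultimately show ?thesis by (simp add: Int_interval box_Int_box negligible_interval(1))
  qed
  have D_diff: "measure lebesgue (\<Union>D - S) \<le> e"
    using D(4-6) S(1) by (simp add: measurable_measure_Diff fmeasurableD)
  show ?thesis
  proof (cases "D = {}")
    case True
    with D(4) have "S = {}" by auto
    show ?thesis
      by (rule that[of "{}"]) (use \<open>S = {}\<close> assms(3,4) in auto)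
  next
    case False
    \<comment> \<open>\<open>from_nat_into\<close> enumerates \<open>D\<close>, possibly with
      repetitions, and needs \<open>D\<close> to be nonempty.\<close>
    define A where "A n = (\<Union>k\<le>n. from_nat_into D k)" for n :: nat
    have in_D: "from_nat_into D k \<in> D" for k using from_nat_into[OF False] .
    have meas: "K \<in> sets lebesgue" if "K \<in> D" for K using D(2)[OF that] by auto
    have UN: "(\<Union>n. A n) = \<Union>D"
    proof -
      have "(\<Union>n. A n) = \<Union>(range (from_nat_into D))" by (auto simp: A_def)
      then show ?thesis by (simp only: range_from_nat_into[OF False D(1)])
    qed
    have "(\<lambda>n. measure lebesgue (A n)) \<longlonglongrightarrow> measure lebesgue (\<Union>n. A n)"
    proof (rule Lim_measure_incseq)
      show "range A \<subseteq> sets lebesgue" unfolding A_def using meas in_D by auto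
      show "incseq A" unfolding A_def incseq_def by (auto intro: order_trans)
      show "emeasure lebesgue (\<Union>n. A n) \<noteq> \<infinity>" unfolding UN using fmeasurableD2[OF D(5)] by simp
    qed
    moreover have "s < measure lebesgue (\<Union>n. A n)"
      using assms(4) measure_mono_fmeasurable[OF D(4) fmeasurableD[OF S(1)] D(5)] UN by simp
    ultimately have "\<forall>\<^sub>F n in sequentially. s < measure lebesgue (A n)"
      by (rule order_tendstoD)
    then obtain n where n: "s < measure lebesgue (A n)" by (auto simp: eventually_sequentially)
    define F where "F = from_nat_into D ` {..n}"
    have F: "F \<subseteq> D" "\<Union>F = A n" using in_D by (auto simp: F_def A_def)
    show ?thesis
    proof (rule that[of F])
      show "pairwise (\<lambda>K L. negligible (K \<inter> L)) F"
        using F(1) negl by (auto simp: pairwise_def)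
      have "measure lebesgue (\<Union>F - S) \<le> measure lebesgue (\<Union>D - S)"
      proof (rule measure_mono_fmeasurable)
        have "\<Union>F \<in> sets lebesgue" unfolding F(2) A_def using meas in_D by auto
        then show "\<Union>F - S \<in> sets lebesgue" using S(1) by (auto simp: fmeasurableD)
        show "\<Union>D - S \<in> lmeasurable" using D(5) S(1) by (rule fmeasurable.Diff)
      qed (use F(1) in auto)
      then show "measure lebesgue (\<Union>F - S) \<le> e" using D_diff by linarith
    qed (use D(2) F n in \<open>auto simp: F_def\<close>)
  qed
qed

text \<open>Boxes approximating \<open>A\<close> have union \<open>U\<close>. Hits in
  \<open>U\<close> grow at least at rate \<open>\<kappa> * \<alpha> / 2\<close>, up to a constant,
  with \<open>\<alpha>\<close> the measure of \<open>A\<close>; hits in \<open>A\<close> stay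
  bounded, and the small remainder \<open>V\<close> accounts for at most half of that rate.\<close>

lemma measure_zero_if_rarely_hit:
  fixes \<phi> :: "nat \<Rightarrow> real" and T :: "nat \<Rightarrow> 'a::euclidean_space set"
  assumes T: "\<And>q. T q \<in> sets borel" "\<And>q. T q \<subseteq> cbox a b"
    and S: "\<And>B. \<exists>n. B < (\<Sum>q=1..n. \<phi> q)"
    and pairs: "\<And>n. 1 \<le> (\<Sum>q=1..n. \<phi> q) \<Longrightarrow>
        (\<Sum>p=1..n. \<Sum>q=1..n. measure lborel (T p \<inter> T q)) \<le> C * (\<Sum>q=1..n. \<phi> q)\<^sup>2" "0 < C"
    and box: "\<And>u v. cbox u v \<subseteq> cbox a b \<Longrightarrow> \<exists>D. \<forall>n. \<kappa> * measure lborel (cbox u v) * (\<Sum>q=1..n. \<phi> q)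
        \<le> D + (\<Sum>q=1..n. measure lborel (cbox u v \<inter> T q))" "0 < \<kappa>"
    and A: "A \<in> lmeasurable" "A \<subseteq> cbox a b" "\<And>q. K \<le> q \<Longrightarrow> A \<inter> T q = {}"
  shows "measure lebesgue A = 0"
proof (rule ccontr)
  let ?\<mu> = "measure lebesgue"
  define \<alpha> where "\<alpha> = ?\<mu> A"
  assume "?\<mu> A \<noteq> 0"
  then have "0 < \<alpha>" by (simp add: \<alpha>_def less_le)
  \<comment> \<open>The choices make \<open>\<tau> * C\<close> and
    \<open>\<epsilon> / \<tau>\<close> both equal to \<open>\<kappa> * \<alpha> / 8\<close>,
    together half of the rate forced by the boxes.\<close>
  define \<tau> where "\<tau> = \<kappa> * \<alpha> / (8 * C)"
  define \<epsilon> where "\<epsilon> = \<tau> * (\<kappa> * \<alpha> / 8)"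
  have "0 < \<tau>" "0 < \<epsilon>" using \<open>0 < \<alpha>\<close> pairs(2) box(2) by (simp_all add: \<tau>_def \<epsilon>_def)
  obtain F where F: "finite F" "\<And>K. K \<in> F \<Longrightarrow> K \<subseteq> cbox a b \<and> (\<exists>c d. K = cbox c d)"
    "pairwise (\<lambda>K L. negligible (K \<inter> L)) F" "\<alpha> / 2 < ?\<mu> (\<Union>F)" "?\<mu> (\<Union>F - A) \<le> \<epsilon>"
    using measurable_finite_boxes_approx[OF A(1,2) \<open>0 < \<epsilon>\<close>, of "\<alpha> / 2"] \<open>0 < \<alpha>\<close> by (auto simp: \<alpha>_def)
  define U where "U = \<Union>F"
  define V where "V = U - A"
  have T_fm: "T q \<in> lmeasurable" for q
    by (rule fmeasurableI2[OF lmeasurable_cbox T(2)]) (use T(1) in auto)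
  have F_fm: "B \<in> lmeasurable" if "B \<in> F" for B using F(2)[OF that] by auto
  have U_fm: "U \<in> lmeasurable" unfolding U_def using F(1) F_fm by (intro fmeasurable.finite_Union) auto
  have V_fm: "V \<in> lmeasurable" unfolding V_def using U_fm A(1) by (rule fmeasurable.Diff)
  have "\<exists>D. \<forall>n. \<kappa> * ?\<mu> B * (\<Sum>q=1..n. \<phi> q) \<le> D + (\<Sum>q=1..n. ?\<mu> (B \<inter> T q))" if "B \<in> F" for B
    using F(2)[OF that] box(1) T(1) by auto
  then obtain D where D: "\<And>B n. B \<in> F \<Longrightarrow> \<kappa> * ?\<mu> B * (\<Sum>q=1..n. \<phi> q) \<le> D B + (\<Sum>q=1..n. ?\<mu> (B \<inter> T q))"
    by metis
  have \<mu>U: "?\<mu> U = (\<Sum>B\<in>F. ?\<mu> B)"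
    unfolding U_def using F(1,3) F_fm by (intro measure_negligible_finite_Union) auto
  have \<mu>UT: "(\<Sum>B\<in>F. ?\<mu> (B \<inter> T q)) = ?\<mu> (U \<inter> T q)" for q
  proof -
    have "?\<mu> (\<Union>((\<lambda>B. B \<inter> T q) ` F)) = (\<Sum>B\<in>F. ?\<mu> (B \<inter> T q))"
    proof (rule measure_negligible_finite_Union_image)
      show "pairwise (\<lambda>B L. negligible ((B \<inter> T q) \<inter> (L \<inter> T q))) F"
        using F(3) by (intro pairwiseI) (metis (no_types, lifting) Int_lower1 Int_mono negligible_subset pairwiseD)
    qed (use F(1) F_fm T_fm in auto)
    moreover have "\<Union>((\<lambda>B. B \<inter> T q) ` F) = U \<inter> T q" by (auto simp: U_def)
    ultimately show ?thesis by simp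
  qed
  define M where "M = ?\<mu> (cbox a b)"
  have T_le_M: "?\<mu> (A \<inter> T q) \<le> M" for q
    unfolding M_def using T(2) A(1) T_fm by (intro measure_mono_fmeasurable) (auto simp: fmeasurableD)
  have "0 \<le> M" by (simp add: M_def)
  have bound: "\<kappa> * \<alpha> / 4 * (\<Sum>q=1..n. \<phi> q) \<le> sum D F + real K * M" if S1: "1 \<le> (\<Sum>q=1..n. \<phi> q)" for n
  proof -
    define s where "s = (\<Sum>q=1..n. \<phi> q)"
    have "0 < s" using S1 by (simp add: s_def)
    have "\<kappa> * (\<alpha> / 2) * s \<le> \<kappa> * ?\<mu> U * s"
      using F(4) \<open>0 < s\<close> box(2) by (intro mult_right_mono mult_left_mono) (auto simp: U_def)
    also have "\<dots> = (\<Sum>B\<in>F. \<kappa> * ?\<mu> B * s)" by (simp add: \<mu>U sum_distrib_left sum_distrib_right)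
    also have "\<dots> \<le> (\<Sum>B\<in>F. D B + (\<Sum>q=1..n. ?\<mu> (B \<inter> T q)))"
      unfolding s_def by (intro sum_mono D)
    also have "\<dots> = sum D F + (\<Sum>q=1..n. \<Sum>B\<in>F. ?\<mu> (B \<inter> T q))"
      by (simp add: sum.distrib sum.swap[of _ F])
    also have "\<dots> = sum D F + (\<Sum>q=1..n. ?\<mu> (U \<inter> T q))" by (simp add: \<mu>UT)
    also have "(\<Sum>q=1..n. ?\<mu> (U \<inter> T q)) \<le> (\<Sum>q=1..n. ?\<mu> (A \<inter> T q) + ?\<mu> (V \<inter> T q))"
    proof (rule sum_mono)
      fix q
      have "?\<mu> (U \<inter> T q) \<le> ?\<mu> ((A \<inter> T q) \<union> (V \<inter> T q))"
        using A(1) V_fm U_fm T_fm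
        by (intro measure_mono_fmeasurable fmeasurable.Un fmeasurable.Int) (auto simp: V_def fmeasurableD)
      also have "\<dots> \<le> ?\<mu> (A \<inter> T q) + ?\<mu> (V \<inter> T q)"
        using A(1) V_fm T_fm by (intro measure_Un_le) (auto simp: fmeasurableD)
      finally show "?\<mu> (U \<inter> T q) \<le> ?\<mu> (A \<inter> T q) + ?\<mu> (V \<inter> T q)" .
    qed
    also have "\<dots> = (\<Sum>q=1..n. ?\<mu> (A \<inter> T q)) + (\<Sum>q=1..n. ?\<mu> (V \<inter> T q))" by (rule sum.distrib)
    also have "(\<Sum>q=1..n. ?\<mu> (A \<inter> T q)) \<le> (\<Sum>q\<in>{..<K}. M)"
    proof -
      have "(\<Sum>q=1..n. ?\<mu> (A \<inter> T q)) = (\<Sum>q\<in>{q\<in>{1..n}. q < K}. ?\<mu> (A \<inter> T q))"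
        using A(3) by (intro sum.mono_neutral_right) (auto simp: not_less)
      also have "\<dots> \<le> (\<Sum>q\<in>{q\<in>{1..n}. q < K}. M)" by (intro sum_mono T_le_M)
      also have "\<dots> \<le> (\<Sum>q\<in>{..<K}. M)" using \<open>0 \<le> M\<close> by (intro sum_mono2) auto
      finally show ?thesis .
    qed
    \<comment> \<open>With the weight \<open>\<tau> / s\<close> the quadratic pair sum and the
      measure of \<open>V\<close> both contribute at most linearly in \<open>s\<close>.\<close>
    also have "(\<Sum>q=1..n. ?\<mu> (V \<inter> T q)) \<le> \<tau> / s * (\<Sum>p=1..n. \<Sum>q=1..n. ?\<mu> (T p \<inter> T q)) + ?\<mu> V / (\<tau> / s)"
      using V_fm T_fm \<open>0 < \<tau>\<close> \<open>0 < s\<close> by (intro sum_measure_Int_le) auto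
    also have "\<dots> \<le> \<tau> / s * (C * s\<^sup>2) + \<epsilon> / (\<tau> / s)"
    proof (intro add_mono mult_left_mono divide_right_mono)
      show "(\<Sum>p=1..n. \<Sum>q=1..n. ?\<mu> (T p \<inter> T q)) \<le> C * s\<^sup>2"
        using pairs(1)[OF S1] T(1) by (simp add: s_def)
      show "?\<mu> V \<le> \<epsilon>" using F(5) by (simp add: V_def U_def)
    qed (use \<open>0 < \<tau>\<close> \<open>0 < s\<close> in auto)
    also have "\<dots> = \<kappa> * \<alpha> / 4 * s"
      using \<open>0 < s\<close> pairs(2) box(2) \<open>0 < \<alpha>\<close> by (simp add: \<tau>_def \<epsilon>_def power2_eq_square field_simps)
    finally have "\<kappa> * (\<alpha> / 2) * s \<le> sum D F + (real K * M + \<kappa> * \<alpha> / 4 * s)" by simp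
    moreover have "\<kappa> * (\<alpha> / 2) * s = 2 * (\<kappa> * \<alpha> / 4 * s)" by simp
    ultimately show ?thesis unfolding s_def[symmetric] by linarith
  qed
  obtain n where n: "max 1 ((sum D F + real K * M) / (\<kappa> * \<alpha> / 4)) < (\<Sum>q=1..n. \<phi> q)"
    using S by blast
  then have "sum D F + real K * M < \<kappa> * \<alpha> / 4 * (\<Sum>q=1..n. \<phi> q)"
    using \<open>0 < \<alpha>\<close> box(2) by (simp add: pos_divide_less_eq mult.commute)
  with bound[of n] n show False by simp
qed

text \<open>Truncation at 1 brings values into the range of \<open>measure_target_ge\<close>. If the
  truncated sums were bounded, their terms would tend to 0, truncation would eventually do nothing,
  and \<open>\<psi>\<close> itself would be summable.\<close>

lemma divergent_min_one:
  fixes \<psi> :: "nat \<Rightarrow> real"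
  assumes "approx_fun \<psi>" "\<not> summable (\<lambda>r. \<psi> (Suc r))"
  shows "\<exists>n. B < (\<Sum>q=1..n. min 1 (\<psi> q))"
proof (rule ccontr)
  assume *: "\<not> ?thesis"
  have pos: "0 < \<psi> r" for r using assms(1) by (simp add: approx_fun_def)
  have "summable (\<lambda>r. min 1 (\<psi> (Suc r)))"
  proof (rule summableI_nonneg_bounded)
    show "0 \<le> min 1 (\<psi> (Suc r))" for r using pos by (simp add: less_imp_le)
    show "(\<Sum>r<n. min 1 (\<psi> (Suc r))) \<le> B" for n
      using * by (simp add: sum.atLeast1_atMost_eq not_less)
  qed
  then have "(\<lambda>r. min 1 (\<psi> (Suc r))) \<longlonglongrightarrow> 0" by (rule summable_LIMSEQ_zero)
  then have "\<forall>\<^sub>F r in sequentially. min 1 (\<psi> (Suc r)) < 1" by (rule order_tendstoD) simp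
  then have "\<forall>\<^sub>F r in sequentially. \<psi> (Suc r) = min 1 (\<psi> (Suc r))"
    by eventually_elim auto
  then have "summable (\<lambda>r. \<psi> (Suc r)) = summable (\<lambda>r. min 1 (\<psi> (Suc r)))"
    by (rule summable_cong)
  with \<open>summable (\<lambda>r. min 1 (\<psi> (Suc r)))\<close> assms(2) show False by simp
qed

lemma Bad_full_measure:
  assumes x: "x \<in> Bad i j" and ij: "0 \<le> i" "0 \<le> j" "i + j = 1" and "\<psi> \<in> D_set"
  shows "unit_square - W_set i j \<psi> x \<in> null_sets lebesgue"
proof -
  define \<phi> where "\<phi> q = min 1 (\<psi> q)" for q
  have \<psi>: "approx_fun \<psi>" "\<not> summable (\<lambda>r. \<psi> (Suc r))" using assms(5) by (simp_all add: D_set_def)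
  have \<psi>_pos: "0 < \<psi> q" for q using \<psi>(1) by (simp add: approx_fun_def)
  have \<phi>: "0 < \<phi> q" "\<phi> q \<le> 1" "\<phi> q \<le> \<psi> q" "antimono \<phi>" for q
    using \<psi>_pos \<psi>(1) by (auto simp: \<phi>_def approx_fun_def antimono_def min.coboundedI2)
  have irr: "irrational_vec x" using x by (simp add: Bad_def)
  define T where "T q = target i j x (int q) (\<phi> q)" for q
  have square: "unit_square = cbox (0, 0) (1, 1)" by (auto simp: unit_square_def)
  obtain C where C: "0 < C" "\<And>n. 1 \<le> (\<Sum>q=1..n. \<phi> q) \<Longrightarrow>
       (\<Sum>p=1..n. \<Sum>q=1..n. measure lborel (T p \<inter> T q)) \<le> C * (\<Sum>q=1..n. \<phi> q)\<^sup>2"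
    unfolding T_def using sum_measure_pairs_le[where \<phi> = \<phi>, OF x ij \<phi>(1,4)] by blast
  \<comment> \<open>The points missed by all targets from index \<open>K\<close> on. Hits with
    positive \<open>q\<close> alone already fill the square up to a null set.\<close>
  define A where "A K = unit_square - (\<Union>q\<in>{K..}. T q)" for K
  have A_borel: "A K \<in> sets borel" for K
    unfolding A_def T_def square by measurable
  have A_fm: "A K \<in> lmeasurable" for K
    by (rule fmeasurableI2[of unit_square]) (use A_borel in \<open>auto simp: A_def square\<close>)
  have "measure lebesgue (A K) = 0" for K
  proof (rule measure_zero_if_rarely_hit[where T = T and \<phi> = \<phi> and C = C and \<kappa> = "1 / 9" and a = "(0, 0)" and b = "(1, 1)" and K = K])
    show "\<exists>n. B < (\<Sum>q=1..n. \<phi> q)" for B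
      unfolding \<phi>_def by (rule divergent_min_one[OF \<psi>])
    show "\<exists>D. \<forall>n. 1 / 9 * measure lborel (cbox u v) * (\<Sum>q=1..n. \<phi> q)
        \<le> D + (\<Sum>q=1..n. measure lborel (cbox u v \<inter> T q))" if "cbox u v \<subseteq> cbox (0, 0) (1, 1)" for u v
      using sum_measure_box_ge[OF ij irr \<phi>(1,2,4), of u v] that by (simp add: T_def square)
    show "A K \<inter> T q = {}" if "K \<le> q" for q using that by (auto simp: A_def)
  qed (use C A_fm target_subset in \<open>auto simp: T_def A_def square\<close>)
  then have "A K \<in> null_sets lebesgue" for K
    using A_fm by (simp add: negligible_iff_measure flip: negligible_iff_null_sets)
  then have "(\<Union>K. A K) \<in> null_sets lebesgue" by (rule null_sets_UN)
  moreover have "unit_square - W_set i j \<psi> x \<subseteq> (\<Union>K. A K)"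
  proof
    fix \<gamma> assume \<gamma>: "\<gamma> \<in> unit_square - W_set i j \<psi> x"
    let ?Q = "{q::int. q \<noteq> 0 \<and> \<gamma> \<in> target i j x q (\<psi> (nat \<bar>q\<bar>))}"
    have "finite ?Q" using \<gamma> W_set_eq[OF ij(1,2) \<psi>_pos] by auto
    then have "finite (int -` ?Q)" by (rule finite_vimageI) simp
    then obtain K where K: "\<And>q. q \<in> int -` ?Q \<Longrightarrow> q < K"
      by (meson finite_nat_set_iff_bounded)
    \<comment> \<open>\<open>Suc K\<close> rules out \<open>q = 0\<close>, which
      \<open>W_set\<close> excludes.\<close>
    have "\<gamma> \<notin> T q" if "Suc K \<le> q" for q
    proof
      assume "\<gamma> \<in> T q"
      then have "\<gamma> \<in> target i j x (int q) (\<psi> q)"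
        using target_mono[OF ij(1,2), of "\<phi> q" "\<psi> q" x "int q"] \<phi>(1,3)[of q] by (auto simp: T_def)
      then have "q \<in> int -` ?Q" using that by simp
      from K[OF this] that show False by simp
    qed
    then have "\<gamma> \<in> A (Suc K)" using \<gamma> by (auto simp: A_def)
    then show "\<gamma> \<in> (\<Union>K. A K)" by blast
  qed
  ultimately show ?thesis using null_sets_completion_subset by blast
qed

theorem theorem2p1:
  fixes i j :: real
  assumes "i \<ge> 0" and "j \<ge> 0" and "i + j = 1"
  shows "(\<Inter>\<psi>\<in>D_set. V_set i j \<psi>) = Bad i j"
proof
  show "Bad i j \<subseteq> (\<Inter>\<psi>\<in>D_set. V_set i j \<psi>)"
  proof (intro subsetI INT_I)
    fix x \<psi> assume x: "x \<in> Bad i j" and "\<psi> \<in> D_set"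
    let ?W = "W_set i j \<psi> x"
    have null: "unit_square - ?W \<in> null_sets lebesgue"
      using Bad_full_measure[OF x assms \<open>\<psi> \<in> D_set\<close>] .
    have square: "unit_square \<in> sets lebesgue" "emeasure lebesgue unit_square = 1"
      using fmeasurable_unit_square measure_unit_square
      by (auto simp: fmeasurable_def emeasure_eq_ennreal_measure)
    \<comment> \<open>Writing the set as the square minus a null set yields its measurability, since
      Lebesgue measure is complete, as well as its measure.\<close>
    have W: "?W = unit_square - (unit_square - ?W)" by (auto simp: W_set_def)
    have "?W \<in> sets lebesgue" by (subst W) (use square(1) null in auto)
    moreover have "emeasure lebesgue ?W = 1"
      by (subst W) (simp add: emeasure_Diff_null_set[OF null square(1)] square(2))
    ultimately show "x \<in> V_set i j \<psi>" using x by (simp add: V_set_def Bad_def)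
  qed
  show "(\<Inter>\<psi>\<in>D_set. V_set i j \<psi>) \<subseteq> Bad i j"
  proof (rule subsetI, rule ccontr)
    fix x assume V: "x \<in> (\<Inter>\<psi>\<in>D_set. V_set i j \<psi>)" and "x \<notin> Bad i j"
    \<comment> \<open>An intersection over an empty family would be everything; a concrete member of
      \<open>D_set\<close> is what places \<open>x\<close> in the square and makes it
      irrational.\<close>
    have "(\<lambda>r. 1) \<in> D_set" by (auto simp: D_set_def approx_fun_def antimono_def summable_const_iff)
    with V have "x \<in> unit_square" "irrational_vec x" by (auto simp: V_set_def)
    then obtain \<psi> where \<psi>: "\<psi> \<in> D_set" "W_set i j \<psi> x \<in> null_sets lebesgue"
      using not_Bad_null \<open>x \<notin> Bad i j\<close> assms by metis
    from V \<psi>(1) have "emeasure lebesgue (W_set i j \<psi> x) = 1" by (auto simp: V_set_def)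
    with \<psi>(2) show False by auto
  qed
qed

end
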